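(* There exist universal constants $C, c, c_0>0$ such that the following holds. Let $\varepsilon\in(0,1)$, let $n\ge c_0/\varepsilon^2$ be even, and let $P=\{e_1,\dots,e_n\}\subset\mathbb{R}^n$ be the standard basis vectors. Let $G\in\mathbb{R}^{t\times n}$ be a Gaussian JL map, where $$\frac{C\log(1/\varepsilon)}{\varepsilon^2}\le t\le\frac{\log n}{C\log(1/\varepsilon)}.$$ Then with probability at least $1-\exp(-c\,n\varepsilon^2)-n^{-50}$, $$\operatorname{opt}_{\mathrm{max\text{-}match}}(G(P))\ge(\sqrt2-\varepsilon)\cdot\operatorname{opt}_{\mathrm{max\text{-}match}}(P).$$
   Context: Norms are Euclidean. A Gaussian JL map is a random $t\times n$ matrix $G$ with i.i.d. $\mathcal{N}(0,1/t)$ entries, and $G(P)=\{Gp:p\in P\}$. For a finite point set $Q$, $\operatorname{opt}_{\mathrm{max\text{-}match}}(Q)$ is the maximum of $\sum_{\{p,q\}\in M}\|p-q\|$ over all matchings $M$ of the complete graph on $Q$. *)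

theory Defs
  imports "HOL-Probability.Probability"
begin

text \<open>Points of R^d are represented as functions nat => real; only coordinates < d matter.
  Euclidean distance in R^d:\<close>
definition edist :: "nat \<Rightarrow> (nat \<Rightarrow> real) \<Rightarrow> (nat \<Rightarrow> real) \<Rightarrow> real" where
  "edist d p q = sqrt (\<Sum>k<d. (p k - q k)^2)"

text \<open>Matchings of the complete graph on Q, each edge stored once as an ordered pair;
  distinct edges are vertex-disjoint.\<close>
definition matchings :: "'a set \<Rightarrow> ('a \<times> 'a) set set" where
  "matchings Q = {M. M \<subseteq> Q \<times> Q \<and> (\<forall>(p,q)\<in>M. p \<noteq> q) \<and>
     (\<forall>(p,q)\<in>M. \<forall>(p',q')\<in>M. (p,q) \<noteq> (p',q') \<longrightarrow> {p,q} \<inter> {p',q'} = {})}"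

definition opt_max_match :: "('a \<Rightarrow> 'a \<Rightarrow> real) \<Rightarrow> 'a set \<Rightarrow> real" where
  "opt_max_match w Q = Max ((\<lambda>M. \<Sum>(p,q)\<in>M. w p q) ` matchings Q)"

definition basis_vec :: "nat \<Rightarrow> nat \<Rightarrow> real" where
  "basis_vec i = (\<lambda>k. if k = i then 1 else 0)"

definition gaussian_JL :: "nat \<Rightarrow> nat \<Rightarrow> (nat \<times> nat \<Rightarrow> real) measure" where
  "gaussian_JL t n = PiM ({..<t} \<times> {..<n}) (\<lambda>_. density lborel (normal_density 0 (1 / sqrt (real t))))"

definition apply_mat :: "nat \<Rightarrow> nat \<Rightarrow> (nat \<times> nat \<Rightarrow> real) \<Rightarrow> (nat \<Rightarrow> real) \<Rightarrow> (nat \<Rightarrow> real)" where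
  "apply_mat t n G p = (\<lambda>k. \<Sum>j<n. G (k, j) * p j)"

end

theory Submission
  imports Defs
begin

text \<open>Split the columns of the Gaussian matrix into two halves of size \<open>m = n / 2\<close>. For small \<open>\<epsilon>\<close>, cut
  the space into cubes of diameter \<open>\<delta> = \<epsilon> / 10\<close>. Since \<open>t\<close> is large compared with
  \<open>ln (1/\<epsilon>) / \<epsilon>\<^sup>2\<close>, all but a \<open>\<delta>\<close>-fraction of the Gaussian mass has norm
  between \<open>1 - \<delta>\<close> and 2. A cube meeting this shell has probability at least
  \<open>\<tau> = (\<delta> * exp (-7)) ^ t\<close>, so there are at most \<open>1 / \<tau>\<close> of them, and \<open>1 / \<tau>\<close> is a small power of \<open>n\<close>
  because \<open>t\<close> is small compared with \<open>ln n / ln (1/\<epsilon>)\<close>. By Hoeffding and a union bound,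
  every such cube receives nearly its expected number of points of the first half, and its
  reflection nearly as many of the second half. Matching each cube with its reflection gives edges of
  length about 2, against length \<open>sqrt 2\<close> for the basis vectors. For \<open>\<epsilon>\<close> close to 1 the target
  is so low that matching column \<open>j\<close> with column \<open>m + j\<close> suffices.\<close>

section \<open>Matchings\<close>

definition verts :: "('a \<times> 'a) set \<Rightarrow> 'a set" where
  "verts M = fst ` M \<union> snd ` M"

lemma matchings_subset: "M \<in> matchings Q \<Longrightarrow> M \<subseteq> Q \<times> Q"
  by (simp add: matchings_def)

lemma matchings_verts: "M \<in> matchings Q \<Longrightarrow> verts M \<subseteq> Q"
  by (auto simp: matchings_def verts_def)

lemma finite_matchings: "finite Q \<Longrightarrow> finite (matchings Q)"
  by (rule finite_subset[of _ "Pow (Q \<times> Q)"]) (auto simp: matchings_def)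

lemma matchings_neq: "M \<in> matchings Q \<Longrightarrow> e \<in> M \<Longrightarrow> fst e \<noteq> snd e"
  by (auto simp: matchings_def)

lemma matchings_disjoint:
  "M \<in> matchings Q \<Longrightarrow> e \<in> M \<Longrightarrow> e' \<in> M \<Longrightarrow> e \<noteq> e' \<Longrightarrow> {fst e, snd e} \<inter> {fst e', snd e'} = {}"
  unfolding matchings_def by (cases e, cases e') fastforce

lemma matchingsI:
  assumes "M \<subseteq> Q \<times> Q" "\<And>e. e \<in> M \<Longrightarrow> fst e \<noteq> snd e"
    "\<And>e e'. e \<in> M \<Longrightarrow> e' \<in> M \<Longrightarrow> e \<noteq> e' \<Longrightarrow> {fst e, snd e} \<inter> {fst e', snd e'} = {}"
  shows "M \<in> matchings Q"
  using assms unfolding matchings_def by fastforce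

lemma matchings_mono: "M \<in> matchings Q \<Longrightarrow> Q \<subseteq> R \<Longrightarrow> M \<in> matchings R"
  by (auto simp: matchings_def)

lemma card_matching_le:
  assumes "finite Q" "M \<in> matchings Q"
  shows "2 * card M \<le> card Q"
proof -
  have fM: "finite M"
    using finite_subset[OF matchings_subset[OF assms(2)]] assms(1) by blast
  have "card (\<Union>e\<in>M. {fst e, snd e}) = (\<Sum>e\<in>M. card {fst e, snd e})"
    using matchings_disjoint[OF assms(2)] fM by (intro card_UN_disjoint) auto
  also have "\<dots> = (\<Sum>e\<in>M. 2)"
    using matchings_neq[OF assms(2)] by (intro sum.cong) auto
  finally have "card (\<Union>e\<in>M. {fst e, snd e}) = 2 * card M" by simp
  moreover have "(\<Union>e\<in>M. {fst e, snd e}) \<subseteq> Q"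
    using matchings_subset[OF assms(2)] by auto
  ultimately show ?thesis
    using card_mono[OF assms(1)] by metis
qed

text \<open>Injectivity is asked on the endpoints only. The map may be a choice of indices for given
  points, or send indices to points that coincide off the matching.\<close>

lemma matching_image:
  assumes M: "M \<in> matchings S" and inj: "inj_on f (verts M)"
  shows "map_prod f f ` M \<in> matchings (f ` S)"
    and "(\<Sum>(p,q)\<in>map_prod f f ` M. w p q) = (\<Sum>(i,j)\<in>M. w (f i) (f j))"
proof -
  have vert: "fst e \<in> verts M" "snd e \<in> verts M" if "e \<in> M" for e
    using that by (auto simp: verts_def)
  note eq = inj_on_eq_iff[OF inj]
  show "map_prod f f ` M \<in> matchings (f ` S)"
  proof (rule matchingsI)
    show "map_prod f f ` M \<subseteq> f ` S \<times> f ` S"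
      using matchings_subset[OF M] by auto
  next
    fix e assume "e \<in> map_prod f f ` M"
    then show "fst e \<noteq> snd e"
      using matchings_neq[OF M] vert eq by (auto simp: map_prod_def split_beta)
  next
    fix e e' assume "e \<in> map_prod f f ` M" "e' \<in> map_prod f f ` M" "e \<noteq> e'"
    then obtain d d' where d: "d \<in> M" "d' \<in> M" "d \<noteq> d'"
      "e = (f (fst d), f (snd d))" "e' = (f (fst d'), f (snd d'))"
      by (auto simp: map_prod_def split_beta)
    then show "{fst e, snd e} \<inter> {fst e', snd e'} = {}"
      using matchings_disjoint[OF M d(1,2,3)] vert[OF d(1)] vert[OF d(2)] eq by auto
  qed
  have "inj_on (map_prod f f) M"
  proof (rule inj_onI)
    fix d d' assume d: "d \<in> M" "d' \<in> M" "map_prod f f d = map_prod f f d'"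
    then show "d = d'"
      using vert[OF d(1)] vert[OF d(2)] eq by (cases d; cases d') auto
  qed
  then show "(\<Sum>(p,q)\<in>map_prod f f ` M. w p q) = (\<Sum>(i,j)\<in>M. w (f i) (f j))"
    by (subst sum.reindex) (auto simp: split_beta intro!: sum.cong)
qed

text \<open>Points indexed by \<open>S\<close> may coincide, so a matching of the indices only counts
  if its endpoints are mapped injectively.\<close>

lemma opt_max_match_image_ge:
  assumes "finite S"
  shows "c \<le> opt_max_match w (f ` S) \<longleftrightarrow>
    (\<exists>M\<in>matchings S. inj_on f (verts M) \<and> c \<le> (\<Sum>(i,j)\<in>M. w (f i) (f j)))"
    (is "?L \<longleftrightarrow> ?R")
proof -
  have ne: "{} \<in> matchings (f ` S)" by (simp add: matchings_def)
  have Lge: "?L \<longleftrightarrow> (\<exists>M\<in>matchings (f ` S). c \<le> (\<Sum>(p,q)\<in>M. w p q))"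
    unfolding opt_max_match_def using ne finite_matchings[of "f ` S"] assms
    by (subst Max_ge_iff) auto
  show ?thesis
  proof
    assume ?L
    then obtain M where M: "M \<in> matchings (f ` S)" "c \<le> (\<Sum>(p,q)\<in>M. w p q)"
      using Lge by blast
    \<comment> \<open>One index is chosen over each point of the image. On the chosen indices
      \<open>f\<close> is injective, since \<open>f\<close> after \<open>g\<close> is the identity
      there.\<close>
    define g where "g = inv_into S f"
    have g: "g p \<in> S" "f (g p) = p" if "p \<in> f ` S" for p
      using that by (auto simp: g_def inv_into_into f_inv_into_f)
    have vM: "verts M \<subseteq> f ` S" by (rule matchings_verts[OF M(1)])
    have injg: "inj_on g (verts M)"
      using vM g(2) by (metis inj_on_def subsetD)
    have verts_g: "verts (map_prod g g ` M) = g ` verts M"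
      by (force simp: verts_def map_prod_def split_beta)
    have "map_prod g g ` M \<in> matchings (g ` f ` S)"
      using matching_image(1)[OF M(1) injg] .
    then have 1: "map_prod g g ` M \<in> matchings S"
      by (rule matchings_mono) (use g in auto)
    have 2: "inj_on f (verts (map_prod g g ` M))"
      unfolding verts_g using vM g(2) by (auto simp: inj_on_def) (metis subsetD g(2))
    have "(\<Sum>(i,j)\<in>map_prod g g ` M. w (f i) (f j)) = (\<Sum>(p,q)\<in>M. w (f (g p)) (f (g q)))"
      by (rule matching_image(2)[OF M(1) injg])
    also have "\<dots> = (\<Sum>(p,q)\<in>M. w p q)"
      using matchings_subset[OF M(1)] g by (intro sum.cong) auto
    finally show ?R using 1 2 M(2) by auto
  next
    assume ?R
    then show ?L unfolding Lge using matching_image by metis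
  qed
qed

text \<open>Equally large subsets of the two sides are paired by a bijection. Later \<open>A\<close>
  holds the first-half columns in a cube and \<open>B\<close> the second-half columns in its
  reflection.\<close>

lemma matchings_bipartite:
  assumes "finite A" "finite B" "A \<inter> B = {}"
  shows "\<exists>M\<in>matchings (A \<union> B). M \<subseteq> A \<times> B \<and> card M = min (card A) (card B)"
proof -
  obtain A' where A': "A' \<subseteq> A" "card A' = min (card A) (card B)"
    by (meson obtain_subset_with_card_n min.cobounded1)
  obtain B' where B': "B' \<subseteq> B" "card B' = min (card A) (card B)"
    by (meson obtain_subset_with_card_n min.cobounded2)
  have "finite A'" "finite B'" using A'(1) B'(1) assms(1,2) by (auto intro: finite_subset)
  then obtain h where h: "bij_betw h A' B'"
    using finite_same_card_bij A' B' by metis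
  define M where "M = (\<lambda>a. (a, h a)) ` A'"
  have sub: "M \<subseteq> A \<times> B"
    using A' B' h by (auto simp: M_def bij_betw_def)
  have "M \<in> matchings (A \<union> B)"
  proof (rule matchingsI)
    show "M \<subseteq> (A \<union> B) \<times> (A \<union> B)" using sub by auto
    show "fst e \<noteq> snd e" if "e \<in> M" for e
      using that sub assms(3) by (cases e) auto
    fix e e' assume e: "e \<in> M" "e' \<in> M" "e \<noteq> e'"
    then obtain a a' where a: "a \<in> A'" "a' \<in> A'" "e = (a, h a)" "e' = (a', h a')"
      by (auto simp: M_def)
    then have "h a \<noteq> h a'" using e h by (auto simp: bij_betw_def inj_on_def)
    moreover have "h a \<in> B" "h a' \<in> B" "a \<in> A" "a' \<in> A" using a sub by (auto simp: M_def)
    ultimately show "{fst e, snd e} \<inter> {fst e', snd e'} = {}"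
      using a e assms(3) by auto
  qed
  moreover have "card M = card A'"
    unfolding M_def by (rule card_image) (auto simp: inj_on_def)
  ultimately show ?thesis using A' sub by auto
qed

lemma matchings_UN:
  assumes M: "\<And>z. z \<in> Z \<Longrightarrow> M z \<in> matchings (Q z)" and disj: "disjoint_family_on Q Z"
  shows "(\<Union>z\<in>Z. M z) \<in> matchings (\<Union>z\<in>Z. Q z)"
proof (rule matchingsI)
  show "(\<Union>z\<in>Z. M z) \<subseteq> (\<Union>z\<in>Z. Q z) \<times> (\<Union>z\<in>Z. Q z)"
    using matchings_subset[OF M] by blast
  show "fst e \<noteq> snd e" if "e \<in> (\<Union>z\<in>Z. M z)" for e
    using that matchings_neq[OF M] by blast
  fix e e' assume e: "e \<in> (\<Union>z\<in>Z. M z)" "e' \<in> (\<Union>z\<in>Z. M z)" "e \<noteq> e'"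
  then obtain z z' where z: "z \<in> Z" "z' \<in> Z" "e \<in> M z" "e' \<in> M z'" by auto
  show "{fst e, snd e} \<inter> {fst e', snd e'} = {}"
  proof (cases "z = z'")
    case True
    then show ?thesis using matchings_disjoint[OF M[OF z(1)]] z e by auto
  next
    case False
    then have "Q z \<inter> Q z' = {}" using disj z by (auto simp: disjoint_family_on_def)
    moreover have "{fst e, snd e} \<subseteq> Q z" "{fst e', snd e'} \<subseteq> Q z'"
      using matchings_subset[OF M[OF z(1)]] matchings_subset[OF M[OF z(2)]] z by auto
    ultimately show ?thesis by blast
  qed
qed

section \<open>The optimum for the standard basis\<close>

lemma edist_basis_vec:
  assumes "i < n" "j < n" "i \<noteq> j"
  shows "edist n (basis_vec i) (basis_vec j) = sqrt 2"
proof -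
  have "(\<Sum>k<n. (basis_vec i k - basis_vec j k)\<^sup>2) =
      (\<Sum>k<n. (if k = i then 1 else 0) + (if k = j then 1 else 0))"
    using assms by (intro sum.cong) (auto simp: basis_vec_def)
  also have "\<dots> = 2"
    using assms by (simp add: sum.distrib)
  finally show ?thesis by (simp add: edist_def)
qed

text \<open>A matching of \<open>n\<close> points has at most \<open>n / 2\<close> edges, each of
  length \<open>sqrt 2\<close> here. An upper bound is enough, because this optimum stands on the
  smaller side of the claim.\<close>

lemma opt_max_match_basis_vec_le:
  "opt_max_match (edist n) (basis_vec ` {..<n}) \<le> real n / 2 * sqrt 2"
proof -
  obtain M where M: "M \<in> matchings {..<n}" and inj: "inj_on (basis_vec :: nat \<Rightarrow> _) (verts M)"
    and le: "opt_max_match (edist n) (basis_vec ` {..<n}) \<le> (\<Sum>(i,j)\<in>M. edist n (basis_vec i) (basis_vec j))"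
    using opt_max_match_image_ge[of "{..<n}" "opt_max_match (edist n) (basis_vec ` {..<n})" "edist n" basis_vec]
    by auto
  have "(\<Sum>(i,j)\<in>M. edist n (basis_vec i) (basis_vec j)) = (\<Sum>e\<in>M. sqrt 2)"
    using matchings_subset[OF M] matchings_neq[OF M] by (intro sum.cong) (auto simp: edist_basis_vec)
  also have "\<dots> = real (card M) * sqrt 2" by simp
  also have "\<dots> \<le> real n / 2 * sqrt 2"
    using card_matching_le[OF _ M] by (intro mult_right_mono) auto
  finally show ?thesis using le by simp
qed

section \<open>Gaussian vectors\<close>

abbreviation gauss :: "real \<Rightarrow> real measure" where
  "gauss \<sigma> \<equiv> density lborel (normal_density 0 \<sigma>)"

text \<open>The law of one column of the matrix, that is, of the image of one basis vector. The
  variance \<open>1 / t\<close> makes the expected squared norm 1.\<close>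

definition gauss_vec :: "nat \<Rightarrow> (nat \<Rightarrow> real) measure" where
  "gauss_vec t = PiM {..<t} (\<lambda>_. gauss (1 / sqrt (real t)))"

lemma space_gauss_vec: "space (gauss_vec t) = {..<t} \<rightarrow>\<^sub>E UNIV"
  by (simp add: gauss_vec_def space_PiM)

lemma prob_space_gauss: "\<sigma> > 0 \<Longrightarrow> prob_space (gauss \<sigma>)"
  by (rule prob_space_normal_density)

lemma gauss_vec_measurable_component [measurable]:
  "k < t \<Longrightarrow> (\<lambda>x. x k) \<in> borel_measurable (gauss_vec t)"
  unfolding gauss_vec_def
  by (rule measurable_compose[OF measurable_component_singleton[of k]]) auto

section \<open>Concentration of the squared norm\<close>

text \<open>Multiplying the density by the exponential weight gives another centred normal density,
  of standard deviation \<open>\<sigma> / sqrt R\<close>, times the constant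
  \<open>1 / sqrt R\<close>. Both signs of \<open>a\<close> are used later.\<close>

lemma nn_integral_exp_square_gauss:
  assumes \<sigma>: "\<sigma> > 0" and r: "2 * a * \<sigma>\<^sup>2 < 1"
  shows "(\<integral>\<^sup>+x. ennreal (exp (a * x\<^sup>2)) \<partial>gauss \<sigma>) = ennreal (1 / sqrt (1 - 2 * a * \<sigma>\<^sup>2))"
proof -
  define R where "R = 1 - 2 * a * \<sigma>\<^sup>2"
  have R: "R > 0" using r by (simp add: R_def)
  have eq: "normal_density 0 \<sigma> x * exp (a * x\<^sup>2) = 1 / sqrt R * normal_density 0 (\<sigma> / sqrt R) x" for x
  proof -
    have "- x\<^sup>2 / (2 * \<sigma>\<^sup>2) + a * x\<^sup>2 = - x\<^sup>2 / (2 * (\<sigma> / sqrt R)\<^sup>2)"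
      using \<sigma> R by (simp add: power_divide R_def field_simps)
    then have e: "exp (- x\<^sup>2 / (2 * \<sigma>\<^sup>2)) * exp (a * x\<^sup>2) = exp (- x\<^sup>2 / (2 * (\<sigma> / sqrt R)\<^sup>2))"
      by (simp flip: exp_add)
    have s: "1 / sqrt R * (1 / sqrt (2 * pi * (\<sigma> / sqrt R)\<^sup>2)) = 1 / sqrt (2 * pi * \<sigma>\<^sup>2)"
      using \<sigma> R by (simp add: power_divide real_sqrt_mult real_sqrt_divide)
    have "normal_density 0 \<sigma> x * exp (a * x\<^sup>2)
        = 1 / sqrt (2 * pi * \<sigma>\<^sup>2) * (exp (- x\<^sup>2 / (2 * \<sigma>\<^sup>2)) * exp (a * x\<^sup>2))"
      by (simp add: normal_density_def)
    also have "\<dots> = 1 / sqrt R * (1 / sqrt (2 * pi * (\<sigma> / sqrt R)\<^sup>2)) * exp (- x\<^sup>2 / (2 * (\<sigma> / sqrt R)\<^sup>2))"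
      unfolding e s ..
    finally show ?thesis by (simp add: normal_density_def)
  qed
  have "(\<integral>\<^sup>+x. ennreal (exp (a * x\<^sup>2)) \<partial>gauss \<sigma>)
      = (\<integral>\<^sup>+x. ennreal (normal_density 0 \<sigma> x * exp (a * x\<^sup>2)) \<partial>lborel)"
    by (subst nn_integral_density) (auto simp: ennreal_mult)
  also have "\<dots> = (\<integral>\<^sup>+x. ennreal (1 / sqrt R) * ennreal (normal_density 0 (\<sigma> / sqrt R) x) \<partial>lborel)"
    unfolding eq using R by (subst ennreal_mult) auto
  also have "\<dots> = ennreal (1 / sqrt R) * (\<integral>\<^sup>+x. ennreal (normal_density 0 (\<sigma> / sqrt R) x) \<partial>lborel)"
    by (rule nn_integral_cmult) auto
  also have "(\<integral>\<^sup>+x. ennreal (normal_density 0 (\<sigma> / sqrt R) x) \<partial>lborel) = 1"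
    using \<sigma> R by (subst nn_integral_eq_integral) auto
  finally show ?thesis by (simp add: R_def)
qed

lemma product_prob_space_gauss: "t \<ge> 1 \<Longrightarrow> product_prob_space (\<lambda>_. gauss (1 / sqrt (real t)))"
  using prob_space_gauss[of "1 / sqrt (real t)"]
  by (auto simp: product_prob_space_def product_prob_space_axioms_def product_sigma_finite_def
      intro: prob_space_imp_sigma_finite)

lemma prob_space_gauss_vec: "t \<ge> 1 \<Longrightarrow> prob_space (gauss_vec t)"
  unfolding gauss_vec_def by (rule prob_space_PiM) (rule prob_space_gauss, simp)

text \<open>The chi-square moment generating function. The integrand factors over the independent
  coordinates, and the variance \<open>1 / t\<close> cancels the factor \<open>t\<close> in the
  exponent.\<close>

lemma nn_integral_exp_norm_gauss_vec:
  assumes t: "t \<ge> 1" and a: "2 * a < 1"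
  shows "(\<integral>\<^sup>+x. ennreal (exp (a * real t * (\<Sum>k<t. (x k)\<^sup>2))) \<partial>gauss_vec t) = ennreal ((1 / sqrt (1 - 2 * a)) ^ t)"
proof -
  interpret product_prob_space "\<lambda>_::nat. gauss (1 / sqrt (real t))"
    by (rule product_prob_space_gauss[OF t])
  have "(\<integral>\<^sup>+x. ennreal (exp (a * real t * (\<Sum>k<t. (x k)\<^sup>2))) \<partial>gauss_vec t)
     = (\<integral>\<^sup>+x. (\<Prod>k<t. ennreal (exp (a * real t * (x k)\<^sup>2))) \<partial>gauss_vec t)"
    by (simp add: sum_distrib_left exp_sum prod_ennreal)
  also have "\<dots> = (\<Prod>k<t. \<integral>\<^sup>+x. ennreal (exp (a * real t * x\<^sup>2)) \<partial>gauss (1 / sqrt (real t)))"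
    unfolding gauss_vec_def by (rule product_nn_integral_prod) auto
  also have "(\<integral>\<^sup>+x. ennreal (exp (a * real t * x\<^sup>2)) \<partial>gauss (1 / sqrt (real t))) = ennreal (1 / sqrt (1 - 2 * a))"
    using t a by (subst nn_integral_exp_square_gauss) (auto simp: power_divide)
  finally show ?thesis using a by (simp add: ennreal_power)
qed

text \<open>A Chernoff bound. Keeping the factor \<open>a\<close> on both sides of the condition on
  \<open>S\<close> covers the upper tail (\<open>a > 0\<close>) and the lower tail
  (\<open>a < 0\<close>) at once.\<close>

lemma gauss_vec_exp_bound:
  assumes t: "t \<ge> 1" and a: "2 * a < 1"
    and S: "\<And>x. x \<in> S \<Longrightarrow> a * (\<Sum>k<t. (x k)\<^sup>2) \<ge> a * r" "S \<in> sets (gauss_vec t)"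
  shows "measure (gauss_vec t) S \<le> (exp (- a * r) / sqrt (1 - 2 * a)) ^ t"
proof -
  interpret prob_space "gauss_vec t" by (rule prob_space_gauss_vec[OF t])
  have "emeasure (gauss_vec t) S = (\<integral>\<^sup>+x. indicator S x \<partial>gauss_vec t)"
    using S by simp
  also have "\<dots> \<le> (\<integral>\<^sup>+x. ennreal (exp (- a * r) ^ t) * ennreal (exp (a * real t * (\<Sum>k<t. (x k)\<^sup>2))) \<partial>gauss_vec t)"
  proof (rule nn_integral_mono)
    fix x
    show "indicator S x \<le> ennreal (exp (- a * r) ^ t) * ennreal (exp (a * real t * (\<Sum>k<t. (x k)\<^sup>2)))"
    proof (cases "x \<in> S")
      case True
      have "0 \<le> real t * (a * (\<Sum>k<t. (x k)\<^sup>2) - a * r)"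
        using S(1)[OF True] by (intro mult_nonneg_nonneg) auto
      then have "1 \<le> exp (real t * (a * (\<Sum>k<t. (x k)\<^sup>2) - a * r))" by simp
      also have "\<dots> = exp (- a * r) ^ t * exp (a * real t * (\<Sum>k<t. (x k)\<^sup>2))"
        by (simp flip: exp_of_nat_mult exp_add) (simp add: algebra_simps)
      finally show ?thesis using True
        by (metis ennreal_1 ennreal_leI ennreal_mult' exp_ge_zero indicator_simps(1) mult.commute)
    qed simp
  qed
  also have "\<dots> = ennreal (exp (- a * r) ^ t) * ennreal ((1 / sqrt (1 - 2 * a)) ^ t)"
    by (subst nn_integral_cmult) (auto simp: nn_integral_exp_norm_gauss_vec[OF t a])
  also have "\<dots> = ennreal ((exp (- a * r) / sqrt (1 - 2 * a)) ^ t)"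
    using a by (simp flip: ennreal_mult add: power_divide)
  finally show ?thesis
    using a by (subst (asm) emeasure_eq_measure, subst (asm) ennreal_le_iff) auto
qed

lemma gauss_vec_norm_upper_tail:
  assumes t: "t \<ge> 1"
  shows "measure (gauss_vec t) {x\<in>space (gauss_vec t). (\<Sum>k<t. (x k)\<^sup>2) > 4} \<le> exp (- real t / 2)"
proof -
  \<comment> \<open>The Chernoff parameters are \<open>a = 1/4\<close> and \<open>r = 4\<close>,
    giving the base \<open>sqrt 2 / e\<close>, which is at most \<open>exp (-1/2)\<close>.\<close>
  have "measure (gauss_vec t) {x\<in>space (gauss_vec t). (\<Sum>k<t. (x k)\<^sup>2) > 4}
      \<le> (exp (- (1/4) * 4) / sqrt (1 - 2 * (1/4))) ^ t"
    by (rule gauss_vec_exp_bound[OF t]) auto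
  also have "\<dots> = (sqrt 2 * exp (-1)) ^ t"
    by (simp add: real_sqrt_divide mult.commute)
  also have "\<dots> \<le> (exp (1/2) * exp (-1)) ^ t"
  proof (intro power_mono mult_right_mono)
    have "(2::real) \<le> exp 1" using exp_ge_add_one_self[of 1] by simp
    then show "sqrt 2 \<le> exp (1/2)"
      by (intro real_le_lsqrt) (auto simp flip: exp_of_nat_mult)
  qed auto
  also have "\<dots> = exp (- real t / 2)"
    by (simp flip: exp_of_nat_mult exp_add)
  finally show ?thesis .
qed

lemma gauss_vec_norm_lower_tail:
  assumes t: "t \<ge> 1" and \<delta>: "0 < \<delta>" "\<delta> \<le> 1"
  shows "measure (gauss_vec t) {x\<in>space (gauss_vec t). (\<Sum>k<t. (x k)\<^sup>2) < 1 - \<delta>} \<le> exp (- real t * \<delta>\<^sup>2 / 8)"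
proof -
  \<comment> \<open>Here \<open>a = -\<delta>/4\<close> and \<open>r = 1 - \<delta>\<close>. With
    \<open>ln (1 + y) \<ge> y - y^2\<close> at \<open>y = \<delta>/2\<close>, the terms linear in
    \<open>\<delta>\<close> cancel and \<open>-\<delta>^2/8\<close> remains.\<close>
  have "measure (gauss_vec t) {x\<in>space (gauss_vec t). (\<Sum>k<t. (x k)\<^sup>2) < 1 - \<delta>}
      \<le> (exp (- (-\<delta>/4) * (1 - \<delta>)) / sqrt (1 - 2 * (-\<delta>/4))) ^ t"
    using \<delta> by (intro gauss_vec_exp_bound[OF t]) auto
  also have "\<dots> \<le> exp (- (\<delta>\<^sup>2 / 8)) ^ t"
  proof (rule power_mono)
    have "\<delta>/2 - (\<delta>/2)\<^sup>2 \<le> ln (1 + \<delta>/2)"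
      using \<delta> by (intro ln_one_plus_pos_lower_bound) auto
    then have "exp (\<delta>/2 - (\<delta>/2)\<^sup>2) \<le> 1 + \<delta>/2"
      using \<delta> by (subst (asm) ln_ge_iff) auto
    then have "sqrt (exp (\<delta>/2 - (\<delta>/2)\<^sup>2)) \<le> sqrt (1 + \<delta>/2)" by simp
    also have "sqrt (exp (\<delta>/2 - (\<delta>/2)\<^sup>2)) = exp ((\<delta>/2 - (\<delta>/2)\<^sup>2)/2)"
      by (rule real_sqrt_unique) (auto simp flip: exp_of_nat_mult)
    finally have "exp (\<delta>/4 * (1 - \<delta>)) / sqrt (1 + \<delta>/2) \<le> exp (\<delta>/4 * (1 - \<delta>)) / exp ((\<delta>/2 - (\<delta>/2)\<^sup>2)/2)"
      by (intro divide_left_mono) (use \<delta> in auto)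
    also have "\<dots> = exp (- (\<delta>\<^sup>2 / 8))"
      unfolding exp_diff[symmetric] by (rule arg_cong[of _ _ exp]) (simp add: field_simps power2_eq_square)
    finally show "exp (- (-\<delta>/4) * (1 - \<delta>)) / sqrt (1 - 2 * (-\<delta>/4)) \<le> exp (- (\<delta>\<^sup>2 / 8))"
      by simp
  qed (use \<delta> in auto)
  also have "\<dots> = exp (- real t * \<delta>\<^sup>2 / 8)"
    by (simp flip: exp_of_nat_mult)
  finally show ?thesis .
qed

text \<open>The sign \<open>s\<close> selects a cell of the grid of side \<open>w\<close> (\<open>s = 1\<close>) or its reflection in
  the origin (\<open>s = -1\<close>).\<close>

definition cube :: "nat \<Rightarrow> real \<Rightarrow> real \<Rightarrow> (nat \<Rightarrow> int) \<Rightarrow> (nat \<Rightarrow> real) set" where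
  "cube t w s z = {x \<in> {..<t} \<rightarrow>\<^sub>E UNIV. \<forall>k<t. \<lfloor>s * x k / w\<rfloor> = z k}"

lemma cube_eq_PiE: "cube t w s z = (\<Pi>\<^sub>E k\<in>{..<t}. {x. \<lfloor>s * x / w\<rfloor> = z k})"
  unfolding cube_def set_eq_iff mem_Collect_eq PiE_iff Ball_def lessThan_iff by blast

lemma sets_cube [measurable]: "cube t w s z \<in> sets (gauss_vec t)"
  unfolding cube_eq_PiE gauss_vec_def by (intro sets_PiM_I_finite) auto

section \<open>Gaussian mass of a cube\<close>

lemma measure_cube:
  assumes t: "t \<ge> 1"
  shows "measure (gauss_vec t) (cube t w s z) = (\<Prod>k<t. measure (gauss (1 / sqrt (real t))) {x. \<lfloor>s * x / w\<rfloor> = z k})"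
proof -
  interpret finite_product_prob_space "\<lambda>_::nat. gauss (1 / sqrt (real t))" "{..<t}"
    using product_prob_space_gauss[OF t]
    by (auto simp: finite_product_prob_space_def finite_product_sigma_finite_def
        finite_product_sigma_finite_axioms_def product_prob_space_def)
  show ?thesis unfolding cube_eq_PiE gauss_vec_def
    by (rule finite_measure_PiM_emb) auto
qed

lemma measure_gauss_uminus:
  assumes A: "A \<in> sets borel"
  shows "measure (gauss \<sigma>) {x. - x \<in> A} = measure (gauss \<sigma>) A"
proof -
  have A': "{x. - x \<in> A} \<in> sets borel" using A by measurable
  have "emeasure (gauss \<sigma>) A = (\<integral>\<^sup>+x. ennreal (normal_density 0 \<sigma> x) * indicator A x \<partial>lborel)"
    using A by (subst emeasure_density) auto
  also have "\<dots> = (\<integral>\<^sup>+x. ennreal (normal_density 0 \<sigma> (- x)) * indicator A (- x) \<partial>lborel)"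
    using A by (subst nn_integral_real_affine[where c="-1" and t=0]) auto
  also have "\<dots> = (\<integral>\<^sup>+x. ennreal (normal_density 0 \<sigma> x) * indicator {x. - x \<in> A} x \<partial>lborel)"
    by (intro nn_integral_cong) (auto simp: normal_density_def indicator_def)
  also have "\<dots> = emeasure (gauss \<sigma>) {x. - x \<in> A}"
    using A' by (subst emeasure_density) auto
  finally show ?thesis by (simp add: measure_def)
qed

text \<open>The normal density is even, so each coordinate factor is unchanged. Hence a cube and its
  reflection expect equally many columns from halves of equal size.\<close>

lemma measure_cube_uminus:
  assumes t: "t \<ge> 1"
  shows "measure (gauss_vec t) (cube t w (-1) z) = measure (gauss_vec t) (cube t w 1 z)"
  unfolding measure_cube[OF t]
proof (rule prod.cong[OF refl])
  fix k
  have "{x::real. \<lfloor>x / w\<rfloor> = z k} \<in> sets borel" by measurable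
  from measure_gauss_uminus[OF this]
  show "measure (gauss (1 / sqrt (real t))) {x. \<lfloor>-1 * x / w\<rfloor> = z k}
     = measure (gauss (1 / sqrt (real t))) {x. \<lfloor>1 * x / w\<rfloor> = z k}"
    by simp
qed

text \<open>The density on the whole interval is bounded below in terms of the given point
  \<open>x0\<close>: any \<open>x\<close> in it has \<open>\<bar>x - x0\<bar> \<le> w\<close>, so
  \<open>x^2 \<le> 2 * x0^2 + 2 * w^2\<close>. Over the coordinates, the bounds then multiply to an
  expression in the norm of one known point.\<close>

lemma measure_gauss_interval_ge:
  fixes x0 :: real
  assumes \<sigma>: "\<sigma> > 0" and w: "w > 0"
  shows "measure (gauss \<sigma>) {x. \<lfloor>x / w\<rfloor> = \<lfloor>x0 / w\<rfloor>} \<ge> w / (\<sigma> * sqrt (2 * pi)) * exp (- (x0\<^sup>2 + w\<^sup>2) / \<sigma>\<^sup>2)"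
proof -
  interpret prob_space "gauss \<sigma>" by (rule prob_space_gauss[OF \<sigma>])
  define j where "j = real_of_int \<lfloor>x0 / w\<rfloor>"
  define c where "c = 1 / (\<sigma> * sqrt (2 * pi)) * exp (- (x0\<^sup>2 + w\<^sup>2) / \<sigma>\<^sup>2)"
  have c: "c \<ge> 0" using \<sigma> by (simp add: c_def)
  have seteq: "{x. \<lfloor>x / w\<rfloor> = \<lfloor>x0 / w\<rfloor>} = {j * w ..< j * w + w}"
    using w by (auto simp: j_def floor_eq_iff field_simps)
  have x0: "x0 \<in> {j * w ..< j * w + w}" unfolding seteq[symmetric] by simp
  have ge: "c \<le> normal_density 0 \<sigma> x" if x: "x \<in> {j * w ..< j * w + w}" for x
  proof -
    have "\<bar>x - x0\<bar> \<le> w" using x x0 by auto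
    then have "(x - x0)\<^sup>2 \<le> w\<^sup>2" by (metis abs_ge_zero power2_abs power_mono)
    moreover have "x\<^sup>2 \<le> 2 * x0\<^sup>2 + 2 * (x - x0)\<^sup>2"
      using zero_le_power2[of "x - 2 * x0"] by (simp add: power2_eq_square algebra_simps)
    ultimately have "x\<^sup>2 / 2 \<le> x0\<^sup>2 + w\<^sup>2" by simp
    then have "x\<^sup>2 / 2 / \<sigma>\<^sup>2 \<le> (x0\<^sup>2 + w\<^sup>2) / \<sigma>\<^sup>2" by (intro divide_right_mono) auto
    then have e: "exp (- (x0\<^sup>2 + w\<^sup>2) / \<sigma>\<^sup>2) \<le> exp (- (x - 0)\<^sup>2 / (2 * \<sigma>\<^sup>2))"
      by (simp add: add_divide_distrib diff_divide_distrib)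
    have s: "\<sigma> * sqrt (2 * pi) = sqrt (2 * pi * \<sigma>\<^sup>2)"
      using \<sigma> by (simp add: real_sqrt_mult)
    show ?thesis
      unfolding c_def normal_density_def s by (rule mult_left_mono[OF e]) simp
  qed
  have "ennreal (c * w) = (\<integral>\<^sup>+x. ennreal c * indicator {j * w ..< j * w + w} x \<partial>lborel)"
    using w c by (subst nn_integral_cmult_indicator) (auto simp: ennreal_mult)
  also have "\<dots> \<le> (\<integral>\<^sup>+x. ennreal (normal_density 0 \<sigma> x) * indicator {j * w ..< j * w + w} x \<partial>lborel)"
    using ge by (intro nn_integral_mono) (auto simp: indicator_def ennreal_leI)
  also have "\<dots> = emeasure (gauss \<sigma>) {j * w ..< j * w + w}"
    by (subst emeasure_density) auto
  finally have "c * w \<le> measure (gauss \<sigma>) {j * w ..< j * w + w}"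
    by (simp add: emeasure_eq_measure)
  then show ?thesis unfolding seteq c_def by (simp add: mult.commute)
qed

lemma measure_cube_ge:
  assumes t: "t \<ge> 1" and \<delta>: "0 < \<delta>" "\<delta> \<le> 1"
    and x: "x \<in> cube t (\<delta> / sqrt (real t)) 1 z" "(\<Sum>k<t. (x k)\<^sup>2) \<le> 4"
  shows "measure (gauss_vec t) (cube t (\<delta> / sqrt (real t)) 1 z) \<ge> (\<delta> * exp (-7)) ^ t"
proof -
  define w where "w = \<delta> / sqrt (real t)"
  define \<sigma> where "\<sigma> = 1 / sqrt (real t)"
  have w: "w > 0" and \<sigma>: "\<sigma> > 0" using t \<delta> by (auto simp: w_def \<sigma>_def)
  have z: "z k = \<lfloor>x k / w\<rfloor>" if "k < t" for k
    using x(1) that by (auto simp: cube_def w_def)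
  have "sqrt (2 * pi) \<le> 3"
    using pi_less_4 by (intro real_le_lsqrt) auto
  also have "(3::real) \<le> exp 2" using exp_ge_add_one_self[of 2] by simp
  finally have spi: "sqrt (2 * pi) \<le> exp 2" .
  \<comment> \<open>The 7 is 2 + 5. The 2 comes from \<open>sqrt (2 * pi) \<le> exp 2\<close>, and
    the 5 bounds the squared norm (at most 4) plus \<open>\<delta>^2\<close> (at most 1).\<close>
  have "(\<delta> * exp (-7)) ^ t \<le> (\<delta> / sqrt (2 * pi)) ^ t * exp (- 5 * real t)"
  proof -
    have "\<delta> * exp (-7) = (\<delta> / exp 2) * exp (-5)"
      by (simp add: mult_exp_exp divide_inverse mult.assoc flip: exp_minus)
    also have "\<dots> \<le> (\<delta> / sqrt (2 * pi)) * exp (-5)"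
      using spi \<delta> by (intro mult_right_mono divide_left_mono) auto
    finally have "(\<delta> * exp (-7)) ^ t \<le> ((\<delta> / sqrt (2 * pi)) * exp (-5)) ^ t"
      using \<delta> by (intro power_mono) auto
    then show ?thesis by (simp only: power_mult_distrib flip: exp_of_nat_mult) (simp add: mult.commute)
  qed
  also have "\<dots> \<le> (\<delta> / sqrt (2 * pi)) ^ t * exp (- real t * ((\<Sum>k<t. (x k)\<^sup>2) + \<delta>\<^sup>2))"
  proof -
    have "(\<Sum>k<t. (x k)\<^sup>2) + \<delta>\<^sup>2 \<le> 5"
      using x(2) \<delta> power_le_one[of \<delta> 2] by simp
    then have "real t * ((\<Sum>k<t. (x k)\<^sup>2) + \<delta>\<^sup>2) \<le> real t * 5" by (intro mult_left_mono) auto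
    then show ?thesis using \<delta> by (intro mult_left_mono) (auto simp: mult.commute)
  qed
  also have "\<dots> = (\<Prod>k<t. w / (\<sigma> * sqrt (2 * pi)) * exp (- ((x k)\<^sup>2 + w\<^sup>2) / \<sigma>\<^sup>2))"
  proof -
    have "(\<Sum>k<t. - ((x k)\<^sup>2 + w\<^sup>2) / \<sigma>\<^sup>2) = - real t * ((\<Sum>k<t. (x k)\<^sup>2) + \<delta>\<^sup>2)"
    proof -
      have "(\<Sum>k<t. - ((x k)\<^sup>2 + w\<^sup>2) / \<sigma>\<^sup>2) = (\<Sum>k<t. - real t * (x k)\<^sup>2 - \<delta>\<^sup>2)"
        using t by (intro sum.cong) (auto simp: w_def \<sigma>_def power_divide field_simps)
      then show ?thesis by (simp add: sum_subtractf sum_negf sum_distrib_left[symmetric] algebra_simps)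
    qed
    moreover have "w / (\<sigma> * sqrt (2 * pi)) = \<delta> / sqrt (2 * pi)"
      using t by (simp add: w_def \<sigma>_def)
    ultimately show ?thesis unfolding prod.distrib exp_sum[OF finite_lessThan, symmetric] by simp
  qed
  also have "\<dots> \<le> (\<Prod>k<t. measure (gauss \<sigma>) {y. \<lfloor>1 * y / w\<rfloor> = z k})"
  proof (intro prod_mono conjI)
    fix k assume "k \<in> {..<t}"
    then show "w / (\<sigma> * sqrt (2 * pi)) * exp (- ((x k)\<^sup>2 + w\<^sup>2) / \<sigma>\<^sup>2) \<le> measure (gauss \<sigma>) {y. \<lfloor>1 * y / w\<rfloor> = z k}"
      using measure_gauss_interval_ge[OF \<sigma> w, of "x k"] z by simp
  qed (use w \<sigma> in auto)
  also have "\<dots> = measure (gauss_vec t) (cube t w 1 z)"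
    unfolding measure_cube[OF t] \<sigma>_def ..
  finally show ?thesis unfolding w_def .
qed

section \<open>Gaussian matrices\<close>

text \<open>Only a lower bound \<open>\<mu>\<close> for the means enters, since for the pair
  distances the exact mean is not computed.\<close>

lemma (in prob_space) Hoeffding_lower_tail:
  assumes J: "finite J" "J \<noteq> {}" and indep: "indep_vars (\<lambda>_. borel) X J"
    and X: "\<And>j \<omega>. j \<in> J \<Longrightarrow> X j \<omega> \<in> {0..b}" and b: "b > 0" and \<eta>: "\<eta> \<ge> 0"
    and \<mu>: "\<And>j. j \<in> J \<Longrightarrow> expectation (X j) \<ge> \<mu>"
  shows "prob {\<omega>\<in>space M. (\<Sum>j\<in>J. X j \<omega>) \<le> real (card J) * (\<mu> - \<eta>)} \<le> exp (- 2 * real (card J) * \<eta>\<^sup>2 / b\<^sup>2)"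
proof -
  define m where "m = real (card J)"
  have m: "m > 0" using J by (simp add: m_def card_gt_0_iff)
  interpret Hoeffding_ineq M J X "\<lambda>_. 0" "\<lambda>_. b" "\<Sum>j\<in>J. expectation (X j)"
    using J X indep by unfold_locales auto
  have "m * \<mu> \<le> (\<Sum>j\<in>J. expectation (X j))"
    using sum_mono[of J "\<lambda>_. \<mu>" "\<lambda>j. expectation (X j)"] \<mu> by (simp add: m_def)
  then have "m * (\<mu> - \<eta>) \<le> (\<Sum>j\<in>J. expectation (X j)) - m * \<eta>"
    by (simp add: algebra_simps)
  then have "prob {\<omega>\<in>space M. (\<Sum>j\<in>J. X j \<omega>) \<le> m * (\<mu> - \<eta>)}
      \<le> prob {\<omega>\<in>space M. (\<Sum>j\<in>J. X j \<omega>) \<le> (\<Sum>j\<in>J. expectation (X j)) - m * \<eta>}"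
    by (intro finite_measure_mono) auto
  also have "\<dots> \<le> exp (- 2 * (m * \<eta>)\<^sup>2 / (\<Sum>j\<in>J. (b - 0)\<^sup>2))"
    using m \<eta> b by (intro Hoeffding_ineq_le) (auto simp: m_def)
  also have "- 2 * (m * \<eta>)\<^sup>2 / (\<Sum>j\<in>J. (b - 0)\<^sup>2) = - 2 * m * \<eta>\<^sup>2 / b\<^sup>2"
    using m b by (simp add: m_def[symmetric] power2_eq_square field_simps)
  finally show ?thesis by (simp add: m_def)
qed

text \<open>Independence means that the joint law is the product of the marginals. The joint law of
  all coordinates is the product measure itself, because restricting to \<open>I\<close> is the
  identity on its space.\<close>

lemma indep_vars_PiM_coordinates:
  assumes N: "prob_space N" and I: "I \<noteq> {}"
  shows "prob_space.indep_vars (PiM I (\<lambda>_. N)) (\<lambda>_. N) (\<lambda>i \<omega>. \<omega> i) I"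
proof -
  interpret prob_space "PiM I (\<lambda>_. N)" by (rule prob_space_PiM[OF N])
  have "distr (PiM I (\<lambda>_. N)) (PiM I (\<lambda>_. N)) (\<lambda>\<omega>. \<lambda>i\<in>I. \<omega> i)
      = distr (PiM I (\<lambda>_. N)) (PiM I (\<lambda>_. N)) (\<lambda>\<omega>. \<omega>)"
    by (rule distr_cong) (auto simp: space_PiM PiE_def extensional_restrict)
  also have "\<dots> = PiM I (\<lambda>_. N)" by simp
  also have "\<dots> = PiM I (\<lambda>i. distr (PiM I (\<lambda>_. N)) N (\<lambda>\<omega>. \<omega> i))"
    by (intro PiM_cong refl) (simp add: distr_PiM_component[OF N])
  finally show ?thesis
    by (subst indep_vars_iff_distr_eq_PiM'[OF I]) auto
qed

section \<open>Columns of the Gaussian matrix\<close>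

text \<open>The restriction makes a column a point of the space of \<open>gauss_vec t\<close>.
  \<open>edist t\<close> does not see it.\<close>

definition col :: "nat \<Rightarrow> nat \<Rightarrow> (nat \<times> nat \<Rightarrow> real) \<Rightarrow> nat \<Rightarrow> real" where
  "col t j G = (\<lambda>k\<in>{..<t}. G (k, j))"

locale gaussian_matrix =
  fixes t n :: nat
  assumes t: "t \<ge> 1" and n: "n \<ge> 1"
begin

abbreviation \<sigma> :: real where "\<sigma> \<equiv> 1 / sqrt (real t)"

lemma \<sigma>_pos: "\<sigma> > 0" using t by simp

sublocale prob_space "gaussian_JL t n"
  unfolding gaussian_JL_def by (rule prob_space_PiM, rule prob_space_gauss, rule \<sigma>_pos)

lemma indep_entries:
  "indep_vars (\<lambda>_. gauss \<sigma>) (\<lambda>i G. G i) ({..<t} \<times> {..<n})"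
  unfolding gaussian_JL_def
  by (rule indep_vars_PiM_coordinates[OF prob_space_gauss[OF \<sigma>_pos]]) (use t n in \<open>simp add: Times_empty lessThan_empty_iff\<close>)

lemma measurable_entry [measurable]:
  "k < t \<Longrightarrow> j < n \<Longrightarrow> (\<lambda>G. G (k, j)) \<in> borel_measurable (gaussian_JL t n)"
  unfolding gaussian_JL_def
  by (rule measurable_compose[OF measurable_component_singleton[of "(k, j)"]]) auto

lemma measurable_col [measurable]:
  "j < n \<Longrightarrow> col t j \<in> measurable (gaussian_JL t n) (gauss_vec t)"
  unfolding gaussian_JL_def gauss_vec_def col_def [abs_def]
  by (intro measurable_restrict measurable_component_singleton) auto

lemma indep_cols: "indep_vars (\<lambda>_. gauss_vec t) (col t) {..<n}"
proof -
  define K where "K j = {..<t} \<times> {j}" for j :: nat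
  have "indep_vars (\<lambda>j. PiM (K j) (\<lambda>_. gauss \<sigma>)) (\<lambda>j \<omega>. restrict (\<lambda>i. \<omega> i) (K j)) {..<n}"
    by (rule indep_vars_restrict[OF indep_entries]) (auto simp: K_def disjoint_family_on_def)
  then have "indep_vars (\<lambda>_. gauss_vec t) (\<lambda>j \<omega>. (\<lambda>x. \<lambda>k\<in>{..<t}. x (k, j)) (restrict (\<lambda>i. \<omega> i) (K j))) {..<n}"
    by (rule indep_vars_compose2, unfold gauss_vec_def K_def)
      (intro measurable_restrict measurable_component_singleton, simp)
  also have "(\<lambda>j \<omega>. (\<lambda>x. \<lambda>k\<in>{..<t}. x (k, j)) (restrict (\<lambda>i. \<omega> i) (K j))) = col t"
    by (auto simp: fun_eq_iff col_def K_def)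
  finally show ?thesis .
qed

lemma distr_col:
  assumes "j < n"
  shows "distr (gaussian_JL t n) (gauss_vec t) (col t j) = gauss_vec t"
  unfolding gaussian_JL_def gauss_vec_def col_def [abs_def]
  using assms distr_PiM_reindex[of "{..<t} \<times> {..<n}" "\<lambda>_. gauss \<sigma>" "\<lambda>k. (k, j)" "{..<t}"]
    prob_space_gauss[OF \<sigma>_pos] by (auto simp: inj_on_def)

lemma prob_col:
  assumes "j < n" "A \<in> sets (gauss_vec t)"
  shows "prob {G\<in>space (gaussian_JL t n). col t j G \<in> A} = measure (gauss_vec t) A"
proof -
  have "measure (gauss_vec t) A = measure (distr (gaussian_JL t n) (gauss_vec t) (col t j)) A"
    using distr_col assms by simp
  also have "\<dots> = prob (col t j -` A \<inter> space (gaussian_JL t n))"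
    using assms by (intro measure_distr) auto
  finally show ?thesis by (simp add: vimage_def Int_def conj_commute)
qed

text \<open>Hoeffding for the indicators that a column falls into \<open>A\<close>, which are
  independent with mean the Gaussian mass of \<open>A\<close>.\<close>

lemma count_lower_tail:
  assumes J: "J \<subseteq> {..<n}" "J \<noteq> {}" and A: "A \<in> sets (gauss_vec t)" and \<eta>: "\<eta> \<ge> 0"
  shows "prob {G\<in>space (gaussian_JL t n). real (card {j\<in>J. col t j G \<in> A})
      \<le> real (card J) * (measure (gauss_vec t) A - \<eta>)} \<le> exp (- 2 * real (card J) * \<eta>\<^sup>2)"
proof -
  have fJ: "finite J" using J finite_subset by blast
  have "indep_vars (\<lambda>_. borel) (\<lambda>j G. indicator A (col t j G) :: real) {..<n}"
    using A by (intro indep_vars_compose2[OF indep_cols]) auto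
  then have indep: "indep_vars (\<lambda>_. borel) (\<lambda>j G. indicator A (col t j G) :: real) J"
    by (rule indep_vars_subset[OF _ J(1)])
  have "expectation (\<lambda>G. indicator A (col t j G)) = measure (gauss_vec t) A" if "j \<in> J" for j
  proof -
    have j: "j < n" using that J by auto
    have "expectation (\<lambda>G. indicator A (col t j G))
       = expectation (indicator {G\<in>space (gaussian_JL t n). col t j G \<in> A})"
      by (intro Bochner_Integration.integral_cong) (auto simp: indicator_def)
    also have "\<dots> = measure (gauss_vec t) A"
      using j A prob_col[OF j A] by simp
    finally show ?thesis .
  qed
  then have "prob {G\<in>space (gaussian_JL t n). (\<Sum>j\<in>J. indicator A (col t j G))
      \<le> real (card J) * (measure (gauss_vec t) A - \<eta>)} \<le> exp (- 2 * real (card J) * \<eta>\<^sup>2 / 1\<^sup>2)"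
    by (intro Hoeffding_lower_tail[OF fJ J(2) indep] \<eta>) (auto simp: indicator_def)
  moreover have "(\<Sum>j\<in>J. indicator A (col t j G)) = real (card {j\<in>J. col t j G \<in> A})" for G
    using fJ by (simp add: indicator_def sum.If_cases Int_def)
  ultimately show ?thesis by simp
qed

section \<open>Almost sure distinctness of the columns\<close>

lemma distributed_entry:
  assumes "k < t" "j < n"
  shows "distributed (gaussian_JL t n) lborel (\<lambda>G. G (k, j)) (normal_density 0 \<sigma>)"
proof -
  have "distr (gaussian_JL t n) lborel (\<lambda>G. G (k, j)) = distr (gaussian_JL t n) (gauss \<sigma>) (\<lambda>G. G (k, j))"
    by (rule distr_cong) auto
  also have "\<dots> = gauss \<sigma>"
    unfolding gaussian_JL_def
    using assms by (intro distr_PiM_component prob_space_gauss \<sigma>_pos) auto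
  finally show ?thesis using assms unfolding distributed_def by auto
qed

lemma distributed_entry_diff:
  assumes "k < t" "i < n" "j < n" "i \<noteq> j"
  shows "distributed (gaussian_JL t n) lborel (\<lambda>G. G (k, i) - G (k, j)) (normal_density 0 (sqrt (2 / real t)))"
proof -
  have "indep_vars (\<lambda>_. borel) (\<lambda>i G. G i) ({..<t} \<times> {..<n})"
    using indep_vars_compose2[OF indep_entries, of "\<lambda>_ x. x" "\<lambda>_. borel"] by auto
  then have "indep_vars (\<lambda>_. borel) (\<lambda>i G. G i) {(k, i), (k, j)}"
    by (rule indep_vars_subset) (use assms in auto)
  then have "indep_var borel (\<lambda>G. G (k, i)) borel (\<lambda>G. G (k, j))"
    using indep_vars_sum[of "{(k, j)}" "(k, i)" "\<lambda>i G. G i"] assms by simp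
  from diff_indep_normal[OF this \<sigma>_pos \<sigma>_pos distributed_entry distributed_entry] assms
  show ?thesis using t by (simp add: power_divide)
qed

lemma AE_cols_distinct:
  assumes "i < n" "j < n" "i \<noteq> j"
  shows "AE G in gaussian_JL t n. G (0, i) \<noteq> G (0, j)"
proof -
  have d: "distributed (gaussian_JL t n) lborel (\<lambda>G. G (0, i) - G (0, j)) (normal_density 0 (sqrt (2 / real t)))"
    using t assms by (intro distributed_entry_diff) auto
  have "AE x in lborel. x \<noteq> (0::real)" by (rule AE_lborel_singleton)
  then have "AE x in density lborel (normal_density 0 (sqrt (2 / real t))). x \<noteq> (0::real)"
    by (subst AE_density) auto
  then have "AE x in distr (gaussian_JL t n) lborel (\<lambda>G. G (0, i) - G (0, j)). x \<noteq> (0::real)"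
    unfolding distributed_distr_eq_density[OF d] .
  then have "AE G in gaussian_JL t n. G (0, i) - G (0, j) \<noteq> 0"
    by (rule AE_distrD[OF distributed_measurable[OF d]])
  then show ?thesis by simp
qed

text \<open>The optimum is taken over a set of points, in which equal columns would merge. Row 0
  already separates the columns almost surely, since the difference of two of its entries has a
  density.\<close>

lemma AE_inj_cols:
  "AE G in gaussian_JL t n. inj_on (\<lambda>j k. G (k, j)) {..<n}"
proof -
  have "AE G in gaussian_JL t n. \<forall>i\<in>{..<n}. \<forall>j\<in>{..<n} - {i}. G (0, i) \<noteq> G (0, j)"
    using AE_cols_distinct by (intro AE_finite_allI) auto
  then show ?thesis
    by (rule AE_mp, intro AE_I2) (force simp: inj_on_def dest: fun_cong[of _ _ 0])
qed

section \<open>The projected points and measurability of the event\<close>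

lemma apply_mat_basis_vec:
  "apply_mat t n G ` basis_vec ` {..<n} = (\<lambda>j k. G (k, j)) ` {..<n}"
proof -
  have "apply_mat t n G (basis_vec j) = (\<lambda>k. G (k, j))" if "j < n" for j
    using that by (simp add: apply_mat_def basis_vec_def if_distrib cong: if_cong)
  then show ?thesis by (auto simp: image_image)
qed

text \<open>In terms of matchings of indices the event is a finite union. For each matching, both
  the injectivity on its endpoints and its total length are measurable conditions on finitely many
  entries.\<close>

lemma event_measurable:
  "{G \<in> space (gaussian_JL t n). opt_max_match (edist t) (apply_mat t n G ` basis_vec ` {..<n}) \<ge> c}
     \<in> events"
proof -
  have inj_iff: "inj_on (\<lambda>j k. G (k, j)) V \<longleftrightarrow> (\<forall>i\<in>V. \<forall>j\<in>V - {i}. \<exists>k\<in>{..<t}. G (k, i) \<noteq> G (k, j))"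
    if "G \<in> space (gaussian_JL t n)" for G :: "nat \<times> nat \<Rightarrow> real" and V
  proof -
    \<comment> \<open>Rows from \<open>t\<close> on hold the same default value in every column, so
      columns can only differ in a row below \<open>t\<close>.\<close>
    have out: "G (k, i) = undefined" if "\<not> k < t" for k i
      using \<open>G \<in> space (gaussian_JL t n)\<close> that
      by (auto simp: gaussian_JL_def space_PiM PiE_def extensional_def)
    have "(\<lambda>k. G (k, i)) = (\<lambda>k. G (k, j)) \<longleftrightarrow> (\<forall>k\<in>{..<t}. G (k, i) = G (k, j))" for i j
      using out by (metis lessThan_iff ext)
    then show ?thesis unfolding inj_on_def by blast
  qed
  have Collect_bex: "{x\<in>S. \<exists>e\<in>X. Q e x} = (\<Union>e\<in>X. {x\<in>S. Q e x})" for S X Q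
    by blast
  have "{G \<in> space (gaussian_JL t n). opt_max_match (edist t) (apply_mat t n G ` basis_vec ` {..<n}) \<ge> c}
    = {G \<in> space (gaussian_JL t n). \<exists>E\<in>matchings {..<n}.
        (\<forall>i\<in>verts E. \<forall>j\<in>verts E - {i}. \<exists>k\<in>{..<t}. G (k, i) \<noteq> G (k, j)) \<and>
        c \<le> (\<Sum>e\<in>E. edist t (\<lambda>k. G (k, fst e)) (\<lambda>k. G (k, snd e)))}"
    unfolding apply_mat_basis_vec opt_max_match_image_ge[OF finite_lessThan] split_beta
    by (intro Collect_cong conj_cong refl) (simp only: inj_iff)
  also have "\<dots> = (\<Union>E\<in>matchings {..<n}. {G \<in> space (gaussian_JL t n).
        (\<forall>i\<in>verts E. \<forall>j\<in>verts E - {i}. \<exists>k\<in>{..<t}. G (k, i) \<noteq> G (k, j)) \<and>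
        c \<le> (\<Sum>e\<in>E. edist t (\<lambda>k. G (k, fst e)) (\<lambda>k. G (k, snd e)))})"
    by (rule Collect_bex)
  also have "\<dots> \<in> events"
  proof (intro sets.finite_UN finite_matchings finite_lessThan)
    fix E :: "(nat \<times> nat) set" assume E: "E \<in> matchings {..<n}"
    have v: "i < n" if "i \<in> verts E" for i using matchings_verts[OF E] that by auto
    have fv: "finite (verts E)" using matchings_verts[OF E] finite_subset by blast
    have e: "fst e < n" "snd e < n" if "e \<in> E" for e using matchings_subset[OF E] that by auto
    have m1: "Measurable.pred (gaussian_JL t n)
        (\<lambda>G. \<forall>i\<in>verts E. \<forall>j\<in>verts E - {i}. \<exists>k\<in>{..<t}. G (k, i) \<noteq> G (k, j))"
    proof (intro pred_intros_finite finite_Diff fv finite_lessThan)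
      fix i j k assume "i \<in> verts E" "j \<in> verts E - {i}" "k \<in> {..<t}"
      then have "(\<lambda>G. G (k, i)) \<in> borel_measurable (gaussian_JL t n)"
        "(\<lambda>G. G (k, j)) \<in> borel_measurable (gaussian_JL t n)" using v by auto
      then show "Measurable.pred (gaussian_JL t n) (\<lambda>G. G (k, i) \<noteq> G (k, j))"
        unfolding pred_def by (rule borel_measurable_neq)
    qed
    have m2: "(\<lambda>G. \<Sum>e\<in>E. edist t (\<lambda>k. G (k, fst e)) (\<lambda>k. G (k, snd e))) \<in> borel_measurable (gaussian_JL t n)"
      unfolding edist_def using e
      by (intro borel_measurable_sum borel_measurable_sqrt borel_measurable_power borel_measurable_diff) auto
    note [measurable] = m1 m2
    show "{G \<in> space (gaussian_JL t n).
        (\<forall>i\<in>verts E. \<forall>j\<in>verts E - {i}. \<exists>k\<in>{..<t}. G (k, i) \<noteq> G (k, j)) \<and>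
        c \<le> (\<Sum>e\<in>E. edist t (\<lambda>k. G (k, fst e)) (\<lambda>k. G (k, snd e)))} \<in> events"
      by measurable
  qed
  finally show ?thesis .
qed

end

section \<open>Small epsilon: matching antipodal cubes\<close>

text \<open>Write \<open>2 * x0\<close> as \<open>x - y\<close> plus
  \<open>(x0 - x) + (x0 + y)\<close>. The points \<open>x\<close>, \<open>x0\<close> and
  \<open>-y\<close> share a cell of side \<open>w\<close>, so each coordinate of the remainder is at
  most \<open>2 * w\<close>, and its norm at most \<open>2 * \<delta>\<close>.\<close>

lemma edist_antipodal_cubes:
  assumes t: "t \<ge> 1" and \<delta>: "\<delta> > 0"
    and x: "x \<in> cube t (\<delta> / sqrt (real t)) 1 z" "x0 \<in> cube t (\<delta> / sqrt (real t)) 1 z"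
    and y: "y \<in> cube t (\<delta> / sqrt (real t)) (-1) z"
  shows "edist t x y \<ge> 2 * sqrt (\<Sum>k<t. (x0 k)\<^sup>2) - 2 * \<delta>"
proof -
  define w where "w = \<delta> / sqrt (real t)"
  have w: "w > 0" using t \<delta> by (simp add: w_def)
  have near: "\<bar>a - b\<bar> \<le> w" if "\<lfloor>a / w\<rfloor> = \<lfloor>b / w\<rfloor>" for a b
  proof -
    have "\<bar>a / w - b / w\<bar> \<le> 1" using that by linarith
    then show ?thesis using w by (simp add: abs_le_iff field_simps)
  qed
  have "2 * sqrt (\<Sum>k<t. (x0 k)\<^sup>2) = L2_set (\<lambda>k. 2 * x0 k) {..<t}"
    by (simp add: L2_set_def power_mult_distrib real_sqrt_mult flip: sum_distrib_left)
  also have "(\<lambda>k. 2 * x0 k) = (\<lambda>k. (x k - y k) + (2 * x0 k - x k + y k))" by auto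
  also have "L2_set \<dots> {..<t} \<le> L2_set (\<lambda>k. x k - y k) {..<t} + L2_set (\<lambda>k. 2 * x0 k - x k + y k) {..<t}"
    by (rule L2_set_triangle_ineq)
  also have "L2_set (\<lambda>k. 2 * x0 k - x k + y k) {..<t} \<le> sqrt (\<Sum>k<t. (2 * w)\<^sup>2)"
    unfolding L2_set_def
  proof (intro real_sqrt_le_mono sum_mono)
    fix k assume "k \<in> {..<t}"
    then have "\<lfloor>x k / w\<rfloor> = z k" "\<lfloor>x0 k / w\<rfloor> = z k" "\<lfloor>- y k / w\<rfloor> = z k"
      using x y by (auto simp: cube_def w_def)
    then have "\<bar>x0 k - x k\<bar> \<le> w" "\<bar>x0 k - (- y k)\<bar> \<le> w"
      by (simp_all only: near)
    then have "\<bar>2 * x0 k - x k + y k\<bar> \<le> \<bar>2 * w\<bar>" by linarith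
    then show "(2 * x0 k - x k + y k)\<^sup>2 \<le> (2 * w)\<^sup>2" by (simp only: abs_le_square_iff)
  qed
  also have "sqrt (\<Sum>k<t. (2 * w)\<^sup>2) = 2 * \<delta>"
    using t \<delta> by (simp add: w_def power_mult_distrib power_divide real_sqrt_mult)
  finally show ?thesis by (simp add: edist_def L2_set_def)
qed

section \<open>Cells meeting the shell\<close>

text \<open>The lower bound makes antipodal edges long. The upper bound keeps the mass of a cell
  from being too small.\<close>

definition shell :: "nat \<Rightarrow> real \<Rightarrow> (nat \<Rightarrow> real) set" where
  "shell t \<delta> = {x \<in> space (gauss_vec t). 1 - \<delta> \<le> (\<Sum>k<t. (x k)\<^sup>2) \<and> (\<Sum>k<t. (x k)\<^sup>2) \<le> 4}"

text \<open>Extensional indices give each cell exactly one index, so that distinct indices have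
  disjoint cubes.\<close>

definition shell_cells :: "nat \<Rightarrow> real \<Rightarrow> (nat \<Rightarrow> int) set" where
  "shell_cells t \<delta> = {z \<in> {..<t} \<rightarrow>\<^sub>E UNIV. cube t (\<delta> / sqrt (real t)) 1 z \<inter> shell t \<delta> \<noteq> {}}"

lemma disjoint_cubes:
  "disjoint_family_on (cube t w s) ({..<t} \<rightarrow>\<^sub>E UNIV)"
proof (unfold disjoint_family_on_def, intro ballI impI)
  fix z z' :: "nat \<Rightarrow> int"
  assume z: "z \<in> {..<t} \<rightarrow>\<^sub>E UNIV" "z' \<in> {..<t} \<rightarrow>\<^sub>E UNIV" "z \<noteq> z'"
  show "cube t w s z \<inter> cube t w s z' = {}"
  proof (rule ccontr)
    assume "cube t w s z \<inter> cube t w s z' \<noteq> {}"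
    then have "z k = z' k" if "k < t" for k using that by (auto simp: cube_def)
    then have "z = z'" using z by (intro PiE_ext) auto
    then show False using z by simp
  qed
qed

lemma shell_cells_subset: "shell_cells t \<delta> \<subseteq> {..<t} \<rightarrow>\<^sub>E UNIV"
  by (auto simp: shell_cells_def)

lemma measure_shell_cell_ge:
  assumes "t \<ge> 1" "0 < \<delta>" "\<delta> \<le> 1" "z \<in> shell_cells t \<delta>"
  shows "measure (gauss_vec t) (cube t (\<delta> / sqrt (real t)) 1 z) \<ge> (\<delta> * exp (-7)) ^ t"
  using assms by (auto simp: shell_cells_def shell_def intro: measure_cube_ge)

text \<open>The cells are disjoint with mass at least \<open>(\<delta> * exp (-7)) ^ t\<close> each,
  and the total mass is at most 1. Finiteness follows from the same count applied to finite
  subfamilies.\<close>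

lemma card_shell_cells:
  assumes t: "t \<ge> 1" and \<delta>: "0 < \<delta>" "\<delta> \<le> 1"
  shows "finite (shell_cells t \<delta>)" "real (card (shell_cells t \<delta>)) * (\<delta> * exp (-7)) ^ t \<le> 1"
proof -
  interpret prob_space "gauss_vec t" by (rule prob_space_gauss_vec[OF t])
  define c where "c = cube t (\<delta> / sqrt (real t)) 1"
  define \<tau> where "\<tau> = (\<delta> * exp (-7)) ^ t"
  have \<tau>: "\<tau> > 0" using \<delta> by (simp add: \<tau>_def)
  have *: "real (card F) * \<tau> \<le> 1" if F: "finite F" "F \<subseteq> shell_cells t \<delta>" for F
  proof -
    have "real (card F) * \<tau> = (\<Sum>z\<in>F. \<tau>)" by simp
    also have "\<dots> \<le> (\<Sum>z\<in>F. prob (c z))"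
      unfolding c_def \<tau>_def using F measure_shell_cell_ge[OF t \<delta>] by (intro sum_mono) auto
    also have "\<dots> = prob (\<Union>z\<in>F. c z)"
    proof (rule finite_measure_finite_Union[symmetric])
      show "disjoint_family_on c F" unfolding c_def
        by (rule disjoint_family_on_mono[OF _ disjoint_cubes]) (use F shell_cells_subset in blast)
    qed (use F in \<open>auto simp: c_def sets_cube\<close>)
    also have "\<dots> \<le> 1" by simp
    finally show ?thesis .
  qed
  show fin: "finite (shell_cells t \<delta>)"
  proof (rule ccontr)
    assume "infinite (shell_cells t \<delta>)"
    then obtain F where F: "finite F" "card F = nat \<lceil>2 / \<tau>\<rceil>" "F \<subseteq> shell_cells t \<delta>"
      using infinite_arbitrarily_large by blast
    have "2 / \<tau> \<le> real (card F)" unfolding F(2) by linarith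
    then show False using *[OF F(1,3)] \<tau> by (simp add: field_simps)
  qed
  show "real (card (shell_cells t \<delta>)) * (\<delta> * exp (-7)) ^ t \<le> 1"
    using *[OF fin subset_refl] by (simp add: \<tau>_def)
qed

lemma measure_shell_ge:
  assumes t: "t \<ge> 1" and \<delta>: "0 < \<delta>" "\<delta> \<le> 1"
  shows "measure (gauss_vec t) (shell t \<delta>) \<ge> 1 - 2 * exp (- real t * \<delta>\<^sup>2 / 8)"
proof -
  interpret prob_space "gauss_vec t" by (rule prob_space_gauss_vec[OF t])
  define A where "A = {x\<in>space (gauss_vec t). (\<Sum>k<t. (x k)\<^sup>2) > 4}"
  define B where "B = {x\<in>space (gauss_vec t). (\<Sum>k<t. (x k)\<^sup>2) < 1 - \<delta>}"
  have [measurable]: "A \<in> events" "B \<in> events" unfolding A_def B_def by measurable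
  have "shell t \<delta> = space (gauss_vec t) - (A \<union> B)"
    by (auto simp: shell_def A_def B_def)
  then have "prob (shell t \<delta>) = 1 - prob (A \<union> B)"
    by (simp add: prob_compl)
  moreover have "prob (A \<union> B) \<le> prob A + prob B" by (rule measure_Un_le) auto
  moreover have "prob A \<le> exp (- real t * \<delta>\<^sup>2 / 8)"
  proof -
    \<comment> \<open>The upper tail \<open>exp (-t/2)\<close> is absorbed into the weaker bound for
      the lower tail, so that both contribute the same term.\<close>
    have "real t * \<delta>\<^sup>2 \<le> real t * 4" using power_le_one[of \<delta> 2] \<delta> by (intro mult_left_mono) auto
    then have "exp (- real t / 2) \<le> exp (- real t * \<delta>\<^sup>2 / 8)" by simp
    then show ?thesis using gauss_vec_norm_upper_tail[OF t] unfolding A_def by (rule order_trans[rotated])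
  qed
  moreover have "prob B \<le> exp (- real t * \<delta>\<^sup>2 / 8)"
    unfolding B_def by (rule gauss_vec_norm_lower_tail[OF t \<delta>])
  ultimately show ?thesis by simp
qed

lemma sum_measure_shell_cells_ge:
  assumes t: "t \<ge> 1" and \<delta>: "0 < \<delta>" "\<delta> \<le> 1"
  shows "(\<Sum>z\<in>shell_cells t \<delta>. measure (gauss_vec t) (cube t (\<delta> / sqrt (real t)) 1 z))
    \<ge> 1 - 2 * exp (- real t * \<delta>\<^sup>2 / 8)"
proof -
  interpret prob_space "gauss_vec t" by (rule prob_space_gauss_vec[OF t])
  define c where "c = cube t (\<delta> / sqrt (real t)) 1"
  have "shell t \<delta> \<subseteq> (\<Union>z\<in>shell_cells t \<delta>. c z)"
  proof
    fix x assume x: "x \<in> shell t \<delta>"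
    define z where "z = (\<lambda>k\<in>{..<t}. \<lfloor>1 * x k / (\<delta> / sqrt (real t))\<rfloor>)"
    have "x \<in> c z" using x by (auto simp: c_def cube_def z_def shell_def space_gauss_vec)
    moreover have "z \<in> shell_cells t \<delta>"
      using x \<open>x \<in> c z\<close> by (auto simp: shell_cells_def c_def z_def)
    ultimately show "x \<in> (\<Union>z\<in>shell_cells t \<delta>. c z)" by auto
  qed
  then have "prob (shell t \<delta>) \<le> prob (\<Union>z\<in>shell_cells t \<delta>. c z)"
    using card_shell_cells(1)[OF t \<delta>]
    by (intro finite_measure_mono sets.finite_UN) (auto simp: c_def sets_cube)
  also have "\<dots> = (\<Sum>z\<in>shell_cells t \<delta>. prob (c z))"
  proof (rule finite_measure_finite_Union)
    show "disjoint_family_on c (shell_cells t \<delta>)" unfolding c_def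
      by (rule disjoint_family_on_mono[OF shell_cells_subset disjoint_cubes])
  qed (use card_shell_cells(1)[OF t \<delta>] in \<open>auto simp: c_def sets_cube\<close>)
  finally show ?thesis using measure_shell_ge[OF t \<delta>] by (simp add: c_def)
qed

section \<open>Counting columns in antipodal cells\<close>

context gaussian_matrix
begin

text \<open>The deterministic part: \<open>q z\<close> bounds both counts from below, hence also the
  number of edges between the cell \<open>z\<close> and its reflection. Different cells use disjoint
  vertices, so these matchings combine.\<close>

lemma opt_ge_sum_counts:
  assumes nm: "n = 2 * m" and \<delta>: "0 < \<delta>" "\<delta> \<le> 1/2"
    and inj: "inj_on (\<lambda>j k. G (k, j)) {..<n}"
    and q1: "\<And>z. z \<in> shell_cells t \<delta> \<Longrightarrow> q z \<le> real (card {j\<in>{..<m}. col t j G \<in> cube t (\<delta> / sqrt (real t)) 1 z})"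
    and q2: "\<And>z. z \<in> shell_cells t \<delta> \<Longrightarrow> q z \<le> real (card {j\<in>{m..<n}. col t j G \<in> cube t (\<delta> / sqrt (real t)) (-1) z})"
  shows "opt_max_match (edist t) (apply_mat t n G ` basis_vec ` {..<n}) \<ge> (2 - 4 * \<delta>) * (\<Sum>z\<in>shell_cells t \<delta>. q z)"
proof -
  define H where "H = shell_cells t \<delta>"
  define w where "w = \<delta> / sqrt (real t)"
  define A where "A z = {j\<in>{..<m}. col t j G \<in> cube t w 1 z}" for z
  define B where "B z = {j\<in>{m..<n}. col t j G \<in> cube t w (-1) z}" for z
  have finH: "finite H" unfolding H_def using \<delta> by (intro card_shell_cells[OF t]) auto
  have AB: "finite (A z)" "finite (B z)" "A z \<inter> B z = {}" for z by (auto simp: A_def B_def)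
  have "\<forall>z. \<exists>E\<in>matchings (A z \<union> B z). E \<subseteq> A z \<times> B z \<and> card E = min (card (A z)) (card (B z))"
    using matchings_bipartite[OF AB] by blast
  then obtain E where E: "\<And>z. E z \<in> matchings (A z \<union> B z)" "\<And>z. E z \<subseteq> A z \<times> B z"
      "\<And>z. card (E z) = min (card (A z)) (card (B z))" by metis
  have finE: "finite (E z)" for z
    by (rule finite_subset[OF E(2)]) (use AB in auto)
  have disj: "A z \<inter> A z' = {}" "B z \<inter> B z' = {}" "A z \<inter> B z' = {}"
    if "z \<in> H" "z' \<in> H" "z \<noteq> z'" for z z'
  proof -
    have "cube t w s z \<inter> cube t w s z' = {}" for s
      using disjoint_cubes[of t w s] that shell_cells_subset[of t \<delta>]
      unfolding disjoint_family_on_def H_def by blast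
    then show "A z \<inter> A z' = {}" "B z \<inter> B z' = {}" unfolding A_def B_def by blast+
  qed (auto simp: A_def B_def)
  have disjQ: "disjoint_family_on (\<lambda>z. A z \<union> B z) H"
    unfolding disjoint_family_on_def using disj by blast
  have mat: "(\<Union>z\<in>H. E z) \<in> matchings {..<n}"
  proof (rule matchings_mono)
    show "(\<Union>z\<in>H. E z) \<in> matchings (\<Union>z\<in>H. A z \<union> B z)" by (rule matchings_UN[OF E(1) disjQ])
  qed (auto simp: A_def B_def nm)
  have dist: "2 - 4 * \<delta> \<le> edist t (\<lambda>k. G (k, i)) (\<lambda>k. G (k, j))" if z: "z \<in> H" and ij: "(i, j) \<in> E z" for z i j
  proof -
    \<comment> \<open>The matched columns may lie outside the shell, so the length is compared with
      a shell point \<open>x0\<close> of the cell. It has norm at least \<open>1 - \<delta>\<close>,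
      which gives length at least \<open>2 * (1 - \<delta>) - 2 * \<delta>\<close>.\<close>
    obtain x0 where x0: "x0 \<in> cube t w 1 z" "1 - \<delta> \<le> (\<Sum>k<t. (x0 k)\<^sup>2)"
      using z by (auto simp: H_def shell_cells_def shell_def w_def)
    have "(1 - \<delta>)\<^sup>2 \<le> 1 - \<delta>"
      using \<delta> by (simp add: power2_eq_square mult_left_le_one_le)
    then have "1 - \<delta> \<le> sqrt (\<Sum>k<t. (x0 k)\<^sup>2)"
      using x0 by (intro real_le_rsqrt) auto
    moreover have "col t i G \<in> cube t w 1 z" "col t j G \<in> cube t w (-1) z"
      using ij E(2) by (auto simp: A_def B_def)
    then have "2 * sqrt (\<Sum>k<t. (x0 k)\<^sup>2) - 2 * \<delta> \<le> edist t (col t i G) (col t j G)"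
      using x0 \<delta> unfolding w_def by (intro edist_antipodal_cubes[OF t]) auto
    moreover have "edist t (col t i G) (col t j G) = edist t (\<lambda>k. G (k, i)) (\<lambda>k. G (k, j))"
      by (simp add: edist_def col_def)
    ultimately show ?thesis by simp
  qed
  have "(2 - 4 * \<delta>) * (\<Sum>z\<in>H. q z) \<le> (2 - 4 * \<delta>) * (\<Sum>z\<in>H. real (card (E z)))"
  proof (intro mult_left_mono sum_mono)
    fix z assume "z \<in> H"
    then show "q z \<le> real (card (E z))"
      using q1[of z] q2[of z] unfolding E(3) A_def B_def w_def H_def by (simp add: min_def)
  qed (use \<delta> in auto)
  also have "\<dots> = (\<Sum>z\<in>H. \<Sum>e\<in>E z. 2 - 4 * \<delta>)"
    by (simp add: sum_distrib_right mult.commute)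
  also have "\<dots> \<le> (\<Sum>z\<in>H. \<Sum>(i,j)\<in>E z. edist t (\<lambda>k. G (k, i)) (\<lambda>k. G (k, j)))"
    using dist by (intro sum_mono) auto
  also have "\<dots> = (\<Sum>(i,j)\<in>(\<Union>z\<in>H. E z). edist t (\<lambda>k. G (k, i)) (\<lambda>k. G (k, j)))"
  proof (rule sum.UNION_disjoint[symmetric])
    show "\<forall>z\<in>H. \<forall>z'\<in>H. z \<noteq> z' \<longrightarrow> E z \<inter> E z' = {}"
      using E(2) disj by blast
  qed (use finH finE in auto)
  finally show ?thesis
    unfolding apply_mat_basis_vec opt_max_match_image_ge[OF finite_lessThan] H_def[symmetric]
    using mat inj_on_subset[OF inj matchings_verts[OF mat]] by blast
qed

text \<open>A union bound over at most \<open>1 / \<tau>\<close> cells and two halves controls all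
  counts at once. Outside the bad event, almost every outcome satisfies the deterministic
  bound.\<close>

lemma prob_antipodal_matching:
  assumes nm: "n = 2 * m" and \<delta>: "0 < \<delta>" "\<delta> \<le> 1/2"
    and small: "2 * exp (- real t * \<delta>\<^sup>2 / 8) \<le> \<delta>"
  defines "\<tau> \<equiv> (\<delta> * exp (-7)) ^ t"
  shows "prob {G \<in> space (gaussian_JL t n).
      opt_max_match (edist t) (apply_mat t n G ` basis_vec ` {..<n}) \<ge> (2 - 8 * \<delta>) * real m}
    \<ge> 1 - 2 / \<tau> * exp (- 2 * real m * (\<delta> * \<tau>)\<^sup>2)" (is "prob ?W \<ge> _")
proof -
  define H where "H = shell_cells t \<delta>"
  define w where "w = \<delta> / sqrt (real t)"
  define p where "p z = measure (gauss_vec t) (cube t w 1 z)" for z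
  have m: "m \<ge> 1" using nm n by simp
  have \<tau>: "\<tau> > 0" using \<delta> by (simp add: \<tau>_def)
  have finH: "finite H" and cardH: "real (card H) \<le> 1 / \<tau>"
    using card_shell_cells[OF t, of \<delta>, folded \<tau>_def] \<delta> \<tau> by (auto simp: H_def pos_le_divide_eq)
  have p: "\<tau> \<le> p z" if "z \<in> H" for z
    using measure_shell_cell_ge[OF t, of \<delta> z] \<delta> that by (simp add: H_def p_def w_def \<tau>_def)
  have p_sym: "measure (gauss_vec t) (cube t w (-1) z) = p z" for z
    unfolding p_def by (rule measure_cube_uminus[OF t])
  \<comment> \<open>The additive slack \<open>\<delta> * \<tau>\<close> is at most
    \<open>\<delta> * p z\<close> on shell cells. Avoiding \<open>bad\<close> therefore keeps each
    count above a fraction \<open>1 - \<delta>\<close> of its mean.\<close>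
  define bad where "bad s J z = {G\<in>space (gaussian_JL t n). real (card {j\<in>J. col t j G \<in> cube t w s z})
      \<le> real (card J) * (measure (gauss_vec t) (cube t w s z) - \<delta> * \<tau>)}" for s J z
  have bad_prob: "prob (bad s J z) \<le> exp (- 2 * real m * (\<delta> * \<tau>)\<^sup>2)"
    if "J \<subseteq> {..<n}" "card J = m" for s J z
    unfolding bad_def that(2)[symmetric]
    by (rule count_lower_tail) (use that m \<delta> \<tau> sets_cube in auto)
  have bad_event: "bad s J z \<in> events" if "J \<subseteq> {..<n}" for s J z
  proof -
    have fJ: "finite J" using that finite_subset by blast
    have "(\<lambda>G. \<Sum>j\<in>J. indicator (cube t w s z) (col t j G) :: real) \<in> borel_measurable (gaussian_JL t n)"
      using that sets_cube by (intro borel_measurable_sum borel_measurable_indicator') auto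
    also have "(\<lambda>G. \<Sum>j\<in>J. indicator (cube t w s z) (col t j G)) = (\<lambda>G. real (card {j\<in>J. col t j G \<in> cube t w s z}))"
      using fJ by (simp add: indicator_def sum.If_cases Int_def)
    finally show ?thesis unfolding bad_def by measurable
  qed
  define Bad where "Bad = (\<Union>z\<in>H. bad 1 {..<m} z \<union> bad (-1) {m..<n} z)"
  have Bad_event: "Bad \<in> events"
    unfolding Bad_def using finH nm by (intro sets.finite_UN sets.Un bad_event) auto
  have "prob Bad \<le> (\<Sum>z\<in>H. prob (bad 1 {..<m} z \<union> bad (-1) {m..<n} z))"
    unfolding Bad_def
    by (intro finite_measure_subadditive_finite finH image_subsetI sets.Un bad_event) (auto simp: nm)
  also have "\<dots> \<le> (\<Sum>z\<in>H. 2 * exp (- 2 * real m * (\<delta> * \<tau>)\<^sup>2))"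
  proof (intro sum_mono)
    fix z
    have "prob (bad 1 {..<m} z \<union> bad (-1) {m..<n} z) \<le> prob (bad 1 {..<m} z) + prob (bad (-1) {m..<n} z)"
      using nm by (intro measure_Un_le bad_event) auto
    also have "\<dots> \<le> exp (- 2 * real m * (\<delta> * \<tau>)\<^sup>2) + exp (- 2 * real m * (\<delta> * \<tau>)\<^sup>2)"
      using nm by (intro add_mono bad_prob) auto
    finally show "prob (bad 1 {..<m} z \<union> bad (-1) {m..<n} z) \<le> 2 * exp (- 2 * real m * (\<delta> * \<tau>)\<^sup>2)"
      by simp
  qed
  also have "\<dots> = real (card H) * (2 * exp (- 2 * real m * (\<delta> * \<tau>)\<^sup>2))" by simp
  also have "\<dots> \<le> 1 / \<tau> * (2 * exp (- 2 * real m * (\<delta> * \<tau>)\<^sup>2))"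
    by (intro mult_right_mono cardH) auto
  finally have Bad: "prob Bad \<le> 2 / \<tau> * exp (- 2 * real m * (\<delta> * \<tau>)\<^sup>2)" by simp

  \<comment> \<open>Three losses are collected: \<open>4 * \<delta>\<close> in the edge length, one
    factor \<open>1 - \<delta>\<close> from the counts, and another from the mass missed by the
    shell cells.\<close>
  have total: "(2 - 8 * \<delta>) * real m \<le> (2 - 4 * \<delta>) * (\<Sum>z\<in>H. real m * (1 - \<delta>) * p z)"
  proof -
    have "1 - \<delta> \<le> (\<Sum>z\<in>H. p z)"
      using sum_measure_shell_cells_ge[OF t, of \<delta>] \<delta> small by (simp add: H_def p_def w_def)
    then have "(1 - \<delta>) * (1 - \<delta>) \<le> (1 - \<delta>) * (\<Sum>z\<in>H. p z)" using \<delta> by (intro mult_left_mono) auto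
    moreover have "1 - 2 * \<delta> \<le> (1 - \<delta>) * (1 - \<delta>)"
      using zero_le_square[of \<delta>] by (simp add: algebra_simps)
    ultimately have "1 - 2 * \<delta> \<le> (1 - \<delta>) * (\<Sum>z\<in>H. p z)" by linarith
    then have "(2 - 4 * \<delta>) * (1 - 2 * \<delta>) \<le> (2 - 4 * \<delta>) * ((1 - \<delta>) * (\<Sum>z\<in>H. p z))"
      using \<delta> by (intro mult_left_mono) auto
    moreover have "2 - 8 * \<delta> \<le> (2 - 4 * \<delta>) * (1 - 2 * \<delta>)"
      using zero_le_square[of \<delta>] by (simp add: algebra_simps)
    ultimately have "2 - 8 * \<delta> \<le> (2 - 4 * \<delta>) * ((1 - \<delta>) * (\<Sum>z\<in>H. p z))" by linarith
    then have "(2 - 8 * \<delta>) * real m \<le> (2 - 4 * \<delta>) * ((1 - \<delta>) * (\<Sum>z\<in>H. p z)) * real m"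
      by (rule mult_right_mono) simp
    then show ?thesis unfolding sum_distrib_left[symmetric] by (simp only: mult_ac)
  qed
  have "AE G in gaussian_JL t n. G \<in> space (gaussian_JL t n) - Bad \<longrightarrow> G \<in> ?W"
    using AE_inj_cols
  proof eventually_elim
    case (elim G)
    show ?case
    proof
      assume G: "G \<in> space (gaussian_JL t n) - Bad"
      have large: "real m * (1 - \<delta>) * p z \<le> real (card {j\<in>J. col t j G \<in> cube t w s z})"
        if "z \<in> H" "G \<notin> bad s J z" "card J = m" "measure (gauss_vec t) (cube t w s z) = p z" for s J z
      proof -
        have "(1 - \<delta>) * p z \<le> p z - \<delta> * \<tau>"
          using p[OF that(1)] \<delta> by (simp add: algebra_simps)
        then have "real m * ((1 - \<delta>) * p z) \<le> real m * (p z - \<delta> * \<tau>)" by (rule mult_left_mono) simp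
        then show ?thesis using that G by (auto simp: bad_def mult.assoc)
      qed
      have "(2 - 4 * \<delta>) * (\<Sum>z\<in>shell_cells t \<delta>. real m * (1 - \<delta>) * p z)
          \<le> opt_max_match (edist t) (apply_mat t n G ` basis_vec ` {..<n})"
      proof (rule opt_ge_sum_counts[OF nm \<delta> elim]; fold w_def H_def)
        fix z assume z: "z \<in> H"
        then have good: "G \<notin> bad 1 {..<m} z" "G \<notin> bad (-1) {m..<n} z" using G by (auto simp: Bad_def)
        show "real m * (1 - \<delta>) * p z \<le> real (card {j\<in>{..<m}. col t j G \<in> cube t w 1 z})"
          "real m * (1 - \<delta>) * p z \<le> real (card {j\<in>{m..<n}. col t j G \<in> cube t w (-1) z})"
          by (rule large[OF z good(1) _ p_def[symmetric]], simp)
            (rule large[OF z good(2) _ p_sym], simp add: nm)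
      qed
      then show "G \<in> ?W" using total G by (simp add: H_def)
    qed
  qed
  then have "prob (space (gaussian_JL t n) - Bad) \<le> prob ?W"
    by (rule finite_measure_mono_AE) (rule event_measurable)
  then show ?thesis using Bad Bad_event by (simp add: prob_compl)
qed

end

section \<open>Large epsilon: a fixed matching\<close>

text \<open>A bounded minorant of the distance, as Hoeffding requires, whose Gaussian expectation is a
  product over the coordinates.\<close>

lemma two_minus_exp_le:
  fixes r :: real
  assumes r: "r \<ge> 0"
  shows "2 * (1 - exp (- r\<^sup>2 / 2)) \<le> r"
proof -
  define u where "u = r\<^sup>2 / 2"
  have u: "u \<ge> 0" by (simp add: u_def)
  \<comment> \<open>This is \<open>1 - exp (-u) \<le> 2 * u / (2 + u)\<close> without fractions. The
    function is 0 at 0, and it is nondecreasing because \<open>1 + x \<le> exp x\<close>.\<close>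
  have "(2 + 0) * exp (- 0) - (2 - 0) \<le> (2 + u) * exp (- u) - (2 - u)"
  proof (rule DERIV_nonneg_imp_nondecreasing[OF u])
    fix x :: real assume x: "0 \<le> x" "x \<le> u"
    have "((\<lambda>x. (2 + x) * exp (- x) - (2 - x)) has_real_derivative 1 - (1 + x) * exp (- x)) (at x)"
      by (auto intro!: derivative_eq_intros simp: algebra_simps)
    moreover have "(1 + x) * exp (- x) \<le> exp x * exp (- x)"
      by (intro mult_right_mono exp_ge_add_one_self) auto
    ultimately show "\<exists>y. ((\<lambda>x. (2 + x) * exp (- x) - (2 - x)) has_real_derivative y) (at x) \<and> 0 \<le> y"
      by (intro exI[of _ "1 - (1 + x) * exp (- x)"]) (simp add: mult_exp_exp)
  qed
  then have "(2 + u) * (1 - exp (- u)) \<le> 2 * u" by (simp add: algebra_simps)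
  also have "4 * u \<le> (2 + u) * r"
  proof -
    have "(2 + u) * r - 4 * u = r / 2 * (r - 2)\<^sup>2"
      by (simp add: u_def power2_eq_square field_simps)
    then show ?thesis using r by (metis diff_ge_0_iff_ge divide_nonneg_pos mult_nonneg_nonneg zero_le_power2 zero_less_numeral)
  qed
  then have "2 * u \<le> (2 + u) * (r / 2)" by simp
  finally have "1 - exp (- u) \<le> r / 2"
    using u by (subst (asm) mult_le_cancel_left_pos) auto
  then show ?thesis by (simp add: u_def)
qed

section \<open>Independent pairs of columns\<close>

context gaussian_matrix
begin

text \<open>Column \<open>j\<close> is paired with column \<open>m + j\<close>, so different
  differences read disjoint pairs of entries.\<close>

lemma indep_diffs:
  assumes nm: "n = 2 * m"
  shows "indep_vars (\<lambda>_. borel) (\<lambda>i G. G (fst i, snd i) - G (fst i, m + snd i)) ({..<t} \<times> {..<m})"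
proof -
  define K :: "nat \<times> nat \<Rightarrow> (nat \<times> nat) set" where "K i = {(fst i, snd i), (fst i, m + snd i)}" for i
  have "indep_vars (\<lambda>j. PiM (K j) (\<lambda>_. gauss \<sigma>)) (\<lambda>j \<omega>. restrict (\<lambda>i. \<omega> i) (K j)) ({..<t} \<times> {..<m})"
    by (rule indep_vars_restrict[OF indep_entries]) (auto simp: K_def nm disjoint_family_on_def)
  then have "indep_vars (\<lambda>_. borel) (\<lambda>j \<omega>. (\<lambda>x. x (fst j, snd j) - x (fst j, m + snd j)) (restrict (\<lambda>i. \<omega> i) (K j))) ({..<t} \<times> {..<m})"
  proof (rule indep_vars_compose2)
    fix j assume "j \<in> {..<t} \<times> {..<m}"
    have c: "(\<lambda>x. x i) \<in> borel_measurable (PiM (K j) (\<lambda>_. gauss \<sigma>))" if "i \<in> K j" for i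
      by (rule measurable_compose[OF measurable_component_singleton[OF that]]) simp
    show "(\<lambda>x. x (fst j, snd j) - x (fst j, m + snd j)) \<in> borel_measurable (PiM (K j) (\<lambda>_. gauss \<sigma>))"
      by (intro borel_measurable_diff c) (auto simp: K_def)
  qed
  also have "(\<lambda>j \<omega>. (\<lambda>x. x (fst j, snd j) - x (fst j, m + snd j)) (restrict (\<lambda>i. \<omega> i) (K j)))
      = (\<lambda>i G. G (fst i, snd i) - G (fst i, m + snd i))"
    by (auto simp: K_def fun_eq_iff)
  finally show ?thesis .
qed

text \<open>Each difference has variance \<open>2 / t\<close>, so the integral is a product of
  \<open>t\<close> equal factors. Bernoulli gives \<open>(1 + 2 / t) ^ t \<ge> 3\<close>, which
  makes the bound uniform in \<open>t\<close>.\<close>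

lemma nn_integral_exp_pair_distance:
  assumes nm: "n = 2 * m" and j: "j < m"
  shows "(\<integral>\<^sup>+G. ennreal (exp (- (\<Sum>k<t. (G (k, j) - G (k, m + j))\<^sup>2) / 2)) \<partial>gaussian_JL t n) \<le> ennreal (1 / sqrt 3)"
proof -
  define X where "X k G = G (k, j) - G (k, m + j)" for k and G :: "nat \<times> nat \<Rightarrow> real"
  have "indep_vars (\<lambda>_. borel) (\<lambda>i G. G (fst i, snd i) - G (fst i, m + snd i)) ((\<lambda>k. (k, j)) ` {..<t})"
    by (rule indep_vars_subset[OF indep_diffs[OF nm]]) (use j in auto)
  then have ind: "indep_vars (\<lambda>_. borel) (\<lambda>i G. ennreal (exp (- (G (fst i, snd i) - G (fst i, m + snd i))\<^sup>2 / 2))) ((\<lambda>k. (k, j)) ` {..<t})"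
    by (rule indep_vars_compose2) measurable
  have one: "(\<integral>\<^sup>+G. ennreal (exp (- (X k G)\<^sup>2 / 2)) \<partial>gaussian_JL t n) = ennreal (1 / sqrt (1 + 2 / real t))"
    if k: "k < t" for k
  proof -
    have d: "distributed (gaussian_JL t n) lborel (X k) (normal_density 0 (sqrt (2 / real t)))"
      unfolding X_def using k j nm by (intro distributed_entry_diff) auto
    have "(\<integral>\<^sup>+G. ennreal (exp (- (X k G)\<^sup>2 / 2)) \<partial>gaussian_JL t n)
        = (\<integral>\<^sup>+x. ennreal (exp (- x\<^sup>2 / 2)) \<partial>distr (gaussian_JL t n) lborel (X k))"
      using distributed_measurable[OF d] by (subst nn_integral_distr) auto
    also have "\<dots> = (\<integral>\<^sup>+x. ennreal (exp ((-1/2) * x\<^sup>2)) \<partial>gauss (sqrt (2 / real t)))"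
      unfolding distributed_distr_eq_density[OF d] by simp
    also have "\<dots> = ennreal (1 / sqrt (1 + 2 / real t))"
      using t less_trans[of "-1" 0 "2 / real t"] by (subst nn_integral_exp_square_gauss) auto
    finally show ?thesis .
  qed
  have "(\<integral>\<^sup>+G. ennreal (exp (- (\<Sum>k<t. (G (k, j) - G (k, m + j))\<^sup>2) / 2)) \<partial>gaussian_JL t n)
      = (\<integral>\<^sup>+G. (\<Prod>i\<in>(\<lambda>k. (k, j)) ` {..<t}. ennreal (exp (- (G (fst i, snd i) - G (fst i, m + snd i))\<^sup>2 / 2))) \<partial>gaussian_JL t n)"
    by (subst prod.reindex)
      (auto simp: inj_on_def prod_ennreal exp_sum[symmetric] sum_divide_distrib sum_negf)
  also have "\<dots> = (\<Prod>i\<in>(\<lambda>k. (k, j)) ` {..<t}. \<integral>\<^sup>+G. ennreal (exp (- (G (fst i, snd i) - G (fst i, m + snd i))\<^sup>2 / 2)) \<partial>gaussian_JL t n)"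
    by (rule indep_vars_nn_integral[OF _ ind]) auto
  also have "\<dots> = (\<Prod>k<t. \<integral>\<^sup>+G. ennreal (exp (- (X k G)\<^sup>2 / 2)) \<partial>gaussian_JL t n)"
    by (subst prod.reindex) (auto simp: inj_on_def X_def)
  also have "\<dots> = ennreal (1 / sqrt (1 + 2 / real t)) ^ t"
    by (subst prod.cong[OF refl one]) auto
  also have "\<dots> = ennreal (1 / sqrt ((1 + 2 / real t) ^ t))"
    by (simp add: ennreal_power power_divide real_sqrt_power)
  also have "\<dots> \<le> ennreal (1 / sqrt 3)"
  proof (intro ennreal_leI divide_left_mono real_sqrt_le_mono)
    show "3 \<le> (1 + 2 / real t) ^ t"
      using Bernoulli_inequality[of "2 / real t" t] order_trans[of "-1" 0 "2 / real t"] t by simp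
    show "0 < sqrt ((1 + 2 / real t) ^ t) * sqrt 3"
      using t by (intro mult_pos_pos) (auto intro!: zero_less_power add_pos_nonneg)
  qed auto
  finally show ?thesis .
qed

lemma expectation_pair_distance:
  assumes nm: "n = 2 * m" and j: "j < m"
  shows "expectation (\<lambda>G. 2 * (1 - exp (- (\<Sum>k<t. (G (k, j) - G (k, m + j))\<^sup>2) / 2))) \<ge> 0.84"
proof -
  define Z where "Z G = exp (- (\<Sum>k<t. (G (k, j) - G (k, m + j))\<^sup>2) / 2)" for G :: "nat \<times> nat \<Rightarrow> real"
  have meas: "Z \<in> borel_measurable (gaussian_JL t n)"
  proof -
    have "(\<lambda>G. G (k, j) - G (k, m + j)) \<in> borel_measurable (gaussian_JL t n)" if "k < t" for k
      using that j nm by (intro borel_measurable_diff measurable_entry) auto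
    then have "(\<lambda>G. \<Sum>k<t. (G (k, j) - G (k, m + j))\<^sup>2) \<in> borel_measurable (gaussian_JL t n)"
      by (intro borel_measurable_sum borel_measurable_power) auto
    then show ?thesis unfolding Z_def by measurable
  qed
  have Z: "0 \<le> Z G" "Z G \<le> 1" for G by (auto simp: Z_def sum_nonneg)
  have int: "integrable (gaussian_JL t n) Z"
    by (rule integrable_const_bound[of _ 1]) (use Z meas in auto)
  have "ennreal (expectation Z) \<le> ennreal (1 / sqrt 3)"
    using nn_integral_exp_pair_distance[OF nm j] Z
    by (subst nn_integral_eq_integral[OF int, symmetric]) (auto simp: Z_def)
  then have "expectation Z \<le> 1 / sqrt 3" by (simp add: ennreal_le_iff)
  \<comment> \<open>The rounding of \<open>1 / sqrt 3\<close> that yields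
    \<open>2 * (1 - 0.58) = 0.84\<close>.\<close>
  also have "\<dots> \<le> 0.58"
  proof -
    have "1 / 0.58 \<le> sqrt 3" by (intro real_le_rsqrt) (simp add: power2_eq_square)
    then show ?thesis by (simp add: field_simps)
  qed
  finally have "expectation Z \<le> 0.58" .
  moreover have "expectation (\<lambda>G. 2 * (1 - Z G)) = 2 * (1 - expectation Z)"
    using int by (simp add: prob_space)
  ultimately show ?thesis by (simp add: Z_def)
qed

lemma prob_fixed_matching:
  assumes nm: "n = 2 * m"
  shows "prob {G \<in> space (gaussian_JL t n).
      opt_max_match (edist t) (apply_mat t n G ` basis_vec ` {..<n}) \<ge> 0.74 * real m}
    \<ge> 1 - exp (- 0.005 * real m)" (is "prob ?W \<ge> _")
proof -
  have m: "m \<ge> 1" using nm n by simp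
  define Y where "Y j G = 2 * (1 - exp (- (\<Sum>k<t. (G (k, j) - G (k, m + j))\<^sup>2) / 2))" for j and G :: "nat \<times> nat \<Rightarrow> real"
  have "indep_vars (\<lambda>j. PiM ({..<t} \<times> {j}) (\<lambda>_. borel))
      (\<lambda>j \<omega>. restrict (\<lambda>i. \<omega> (fst i, snd i) - \<omega> (fst i, m + snd i)) ({..<t} \<times> {j})) {..<m}"
    by (rule indep_vars_restrict[OF indep_diffs[OF nm]]) (auto simp: disjoint_family_on_def)
  then have "indep_vars (\<lambda>_. borel) (\<lambda>j \<omega>. (\<lambda>x. 2 * (1 - exp (- (\<Sum>k<t. (x (k, j))\<^sup>2) / 2)))
      (restrict (\<lambda>i. \<omega> (fst i, snd i) - \<omega> (fst i, m + snd i)) ({..<t} \<times> {j}))) {..<m}"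
  proof (rule indep_vars_compose2)
    fix j
    have "(\<lambda>x. \<Sum>k<t. (x (k, j))\<^sup>2 :: real) \<in> borel_measurable (PiM ({..<t} \<times> {j}) (\<lambda>_. borel))"
      by (intro borel_measurable_sum borel_measurable_power measurable_component_singleton) auto
    then show "(\<lambda>x. 2 * (1 - exp (- (\<Sum>k<t. (x (k, j))\<^sup>2) / 2)) :: real) \<in> borel_measurable (PiM ({..<t} \<times> {j}) (\<lambda>_. borel))"
      by measurable
  qed
  also have "(\<lambda>j \<omega>. (\<lambda>x. 2 * (1 - exp (- (\<Sum>k<t. (x (k, j))\<^sup>2) / 2)))
      (restrict (\<lambda>i. \<omega> (fst i, snd i) - \<omega> (fst i, m + snd i)) ({..<t} \<times> {j}))) = Y"
    by (auto simp: fun_eq_iff Y_def)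
  finally have indep: "indep_vars (\<lambda>_. borel) Y {..<m}" .
  define Bad where "Bad = {G\<in>space (gaussian_JL t n). (\<Sum>j<m. Y j G) \<le> real m * (0.84 - 0.1)}"
  have rv: "random_variable borel (Y j)" if "j < m" for j
    using indep that by (auto simp: indep_vars_def)
  have Bad_event: "Bad \<in> events"
  proof -
    have [measurable]: "(\<lambda>G. \<Sum>j<m. Y j G) \<in> borel_measurable (gaussian_JL t n)"
      using rv by (intro borel_measurable_sum) auto
    show ?thesis unfolding Bad_def by measurable
  qed
  \<comment> \<open>Hoeffding with values in \<open>[0, 2]\<close>, mean at least 0.84 and slack
    0.1. This gives the threshold 0.74 and the exponent rate
    \<open>2 * 0.01 / 4 = 0.005\<close>.\<close>
  have "prob Bad \<le> exp (- 2 * real (card {..<m}) * 0.1\<^sup>2 / 2\<^sup>2)"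
    unfolding Bad_def
  proof (subst card_lessThan[of m, symmetric], intro Hoeffding_lower_tail[OF _ _ indep])
    show "0.84 \<le> expectation (Y j)" if "j \<in> {..<m}" for j
      using expectation_pair_distance[OF nm, of j] that unfolding Y_def by simp
  qed (use m in \<open>auto simp: Y_def sum_nonneg lessThan_empty_iff\<close>)
  also have "\<dots> = exp (- 0.005 * real m)" by (simp add: power2_eq_square)
  finally have Bad: "prob Bad \<le> exp (- 0.005 * real m)" .
  define E where "E = (\<lambda>j. (j, m + j)) ` {..<m}"
  have E: "E \<in> matchings {..<n}"
    by (rule matchingsI) (auto simp: E_def nm)
  have "AE G in gaussian_JL t n. G \<in> space (gaussian_JL t n) - Bad \<longrightarrow> G \<in> ?W"
    using AE_inj_cols
  proof eventually_elim
    case (elim G)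
    show ?case
    proof
      assume G: "G \<in> space (gaussian_JL t n) - Bad"
      then have "0.74 * real m \<le> (\<Sum>j<m. Y j G)" by (auto simp: Bad_def)
      also have "\<dots> \<le> (\<Sum>j<m. edist t (\<lambda>k. G (k, j)) (\<lambda>k. G (k, m + j)))"
      proof (rule sum_mono)
        fix j
        have "0 \<le> (\<Sum>k<t. (G (k, j) - G (k, m + j))\<^sup>2)" by (simp add: sum_nonneg)
        then show "Y j G \<le> edist t (\<lambda>k. G (k, j)) (\<lambda>k. G (k, m + j))"
          using two_minus_exp_le[of "edist t (\<lambda>k. G (k, j)) (\<lambda>k. G (k, m + j))"]
          by (simp add: Y_def edist_def)
      qed
      also have "\<dots> = (\<Sum>(i,j)\<in>E. edist t (\<lambda>k. G (k, i)) (\<lambda>k. G (k, j)))"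
        unfolding E_def by (subst sum.reindex) (auto simp: inj_on_def)
      finally have "0.74 * real m \<le> opt_max_match (edist t) (apply_mat t n G ` basis_vec ` {..<n})"
        unfolding apply_mat_basis_vec opt_max_match_image_ge[OF finite_lessThan]
        using E inj_on_subset[OF elim matchings_verts[OF E]] by blast
      then show "G \<in> ?W" using G by simp
    qed
  qed
  then have "prob (space (gaussian_JL t n) - Bad) \<le> prob ?W"
    by (rule finite_measure_mono_AE) (rule event_measurable)
  then show ?thesis using Bad Bad_event by (simp add: prob_compl)
qed

end

section \<open>Choice of constants\<close>

text \<open>Everything is written as an exponential in \<open>L = ln (1/\<epsilon>)\<close> and
  \<open>u = ln n\<close>. As \<open>\<epsilon> \<le> 0.9\<close> forces
  \<open>L \<ge> 1/10\<close>, additive constants in exponents can be absorbed into multiples of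
  \<open>L\<close>.\<close>

lemma antipodal_matching_parameters:
  fixes \<epsilon> :: real and n t :: nat
  assumes \<epsilon>: "0 < \<epsilon>" "\<epsilon> \<le> 0.9" and t: "t \<ge> 1"
    and lower: "48000 * ln (1/\<epsilon>) / \<epsilon>^2 \<le> real t"
    and upper: "real t \<le> ln (real n) / (48000 * ln (1/\<epsilon>))" and n: "n \<ge> 1"
  defines "\<delta> \<equiv> \<epsilon> / 10"
  defines "\<tau> \<equiv> (\<delta> * exp (-7)) ^ t"
  shows "2 * exp (- real t * \<delta>\<^sup>2 / 8) \<le> \<delta>"
    and "2 / \<tau> * exp (- real n * (\<delta> * \<tau>)\<^sup>2) \<le> real n powr (-50)"
proof -
  define L where "L = ln (1/\<epsilon>)"
  define u where "u = ln (real n)"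
  have L: "L \<ge> 1/10" using ln_le_minus_one[of \<epsilon>] \<epsilon> by (simp add: L_def ln_div)
  have eps: "\<epsilon> = exp (- L)" using \<epsilon> by (simp add: L_def ln_div)
  have nu: "real n = exp u" using n by (simp add: u_def)
  have e1: "2 \<le> exp (1::real)" using exp_ge_add_one_self[of 1] by simp
  have "2 ^ 5 \<le> exp (1::real) ^ 5" by (rule power_mono[OF e1]) simp
  also have "\<dots> = exp 5" by (simp flip: exp_of_nat_mult)
  finally have e5: "20 \<le> exp (5::real)" by simp
  have tL: "48000 * L \<le> real t * \<epsilon>\<^sup>2"
    using lower \<epsilon> by (simp add: L_def field_simps)
  have tu: "48000 * (L * real t) \<le> u"
    using upper L by (simp add: L_def[symmetric] u_def field_simps)
  have Lt: "L \<le> L * real t" using L t by (simp add: mult_le_cancel_left1)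
  have u: "u \<ge> 4800" using tu Lt L by linarith

  \<comment> \<open>Since \<open>\<delta>^2 / 8 = \<epsilon>^2 / 800\<close>, the constant 48000
    leaves 60. Of this, \<open>50 * L \<ge> 5\<close> pays for the factor 20.\<close>
  have "2 * exp (- real t * \<delta>\<^sup>2 / 8) \<le> 2 * exp (- 60 * L)"
    using tL by (simp add: \<delta>_def power_divide)
  also have "\<dots> = 20 * exp (- 60 * L) / 10" by simp
  also have "\<dots> \<le> exp 5 * exp (- 60 * L) / 10"
    by (intro divide_right_mono mult_right_mono e5) auto
  also have "\<dots> \<le> exp (- L) / 10"
    using L by (intro divide_right_mono) (auto simp: mult_exp_exp)
  finally show "2 * exp (- real t * \<delta>\<^sup>2 / 8) \<le> \<delta>" by (simp add: \<delta>_def eps)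

  have \<delta>: "\<delta> \<ge> exp (- 51 * L)"
  proof -
    have "exp (- 51 * L) \<le> exp (- 5) * exp (- L)" using L by (simp add: mult_exp_exp)
    also have "\<dots> \<le> 1 / 10 * exp (- L)"
      using e5 by (intro mult_right_mono) (auto simp: exp_minus field_simps)
    finally show ?thesis by (simp add: \<delta>_def eps)
  qed
  \<comment> \<open>The exponent is 51 + 70: 51 from \<open>\<delta>\<close>, and 70 because
    \<open>7 \<le> 70 * L\<close>.\<close>
  have \<tau>: "\<tau> \<ge> exp (- 121 * (L * real t))"
  proof -
    have "exp (- 121 * (L * real t)) = exp (- 121 * L) ^ t"
      by (simp flip: exp_of_nat_mult add: mult_ac)
    also have "\<dots> \<le> (exp (- 51 * L) * exp (-7)) ^ t"
      using L by (intro power_mono) (auto simp: mult_exp_exp)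
    also have "\<dots> \<le> \<tau>"
      unfolding \<tau>_def by (intro power_mono mult_right_mono \<delta>) auto
    finally show ?thesis .
  qed
  have \<tau>0: "\<tau> > 0" using \<tau> by (rule less_le_trans[rotated]) simp
  have inv_\<tau>: "2 / \<tau> \<le> exp (1 + u)"
  proof -
    have "2 / \<tau> \<le> 2 / exp (- 121 * (L * real t))" by (intro divide_left_mono \<tau>) (use \<tau>0 in auto)
    also have "\<dots> = 2 * exp (121 * (L * real t))" by (simp add: exp_minus field_simps)
    also have "\<dots> \<le> exp 1 * exp u" using e1 tu u by (intro mult_mono) auto
    finally show ?thesis by (simp add: exp_add)
  qed
  \<comment> \<open>Both exponents together are at most \<open>172 * L * t\<close>, far below
    \<open>u / 4\<close>. Hence \<open>n * (\<delta> * \<tau>)^2\<close> is at least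
    \<open>exp (u / 2)\<close>.\<close>
  have \<delta>\<tau>: "exp (- u / 4) \<le> \<delta> * \<tau>"
  proof -
    have "exp (- u / 4) \<le> exp (- 51 * L) * exp (- 121 * (L * real t))"
      using tu Lt u by (simp add: mult_exp_exp)
    also have "\<dots> \<le> \<delta> * \<tau>" by (intro mult_mono \<delta> \<tau>) (use \<epsilon> in \<open>auto simp: \<delta>_def\<close>)
    finally show ?thesis .
  qed
  \<comment> \<open>The target power of \<open>n\<close> is 50. The two extra multiples of
    \<open>u\<close> pay for \<open>2 / \<tau> \<le> exp (1 + u)\<close>.\<close>
  have "52 * u \<le> (u / 4)\<^sup>2" using u by (simp add: power2_eq_square field_simps)
  also have "\<dots> \<le> exp (u / 4) ^ 2"
    using order_trans[OF _ exp_ge_add_one_self[of "u / 4"], of "u / 4"] u by (intro power_mono) auto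
  also have "\<dots> = exp u * exp (- u / 4) ^ 2"
    by (simp flip: exp_of_nat_mult add: mult_exp_exp)
  also have "\<dots> \<le> real n * (\<delta> * \<tau>)\<^sup>2"
    unfolding nu by (intro mult_left_mono power_mono \<delta>\<tau>) auto
  finally have "exp (- real n * (\<delta> * \<tau>)\<^sup>2) \<le> exp (- 52 * u)" by simp
  then have "2 / \<tau> * exp (- real n * (\<delta> * \<tau>)\<^sup>2) \<le> exp (1 + u) * exp (- 52 * u)"
    by (intro mult_mono inv_\<tau>) auto
  also have "\<dots> \<le> exp (- 50 * u)" using u by (simp add: mult_exp_exp)
  also have "\<dots> = real n powr (-50)" using n by (simp add: powr_def u_def)
  finally show "2 / \<tau> * exp (- real n * (\<delta> * \<tau>)\<^sup>2) \<le> real n powr (-50)" .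
qed

lemma (in gaussian_matrix) prob_event_antimono:
  assumes "c' \<le> c"
  shows "prob {G \<in> space (gaussian_JL t n). opt_max_match (edist t) (apply_mat t n G ` basis_vec ` {..<n}) \<ge> c}
    \<le> prob {G \<in> space (gaussian_JL t n). opt_max_match (edist t) (apply_mat t n G ` basis_vec ` {..<n}) \<ge> c'}"
  by (rule finite_measure_mono[OF _ event_measurable]) (use assms in auto)

theorem mainTheorem4:
  shows "\<exists>C c c0 :: real. C > 0 \<and> c > 0 \<and> c0 > 0 \<and>
    (\<forall>(\<epsilon>::real) (n::nat) (t::nat).
       0 < \<epsilon> \<and> \<epsilon> < 1 \<and> even n \<and> real n \<ge> c0 / \<epsilon>^2 \<and>
       C * ln (1/\<epsilon>) / \<epsilon>^2 \<le> real t \<and> real t \<le> ln (real n) / (C * ln (1/\<epsilon>)) \<longrightarrow>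
       measure (gaussian_JL t n)
         {G \<in> space (gaussian_JL t n).
            opt_max_match (edist t) (apply_mat t n G ` basis_vec ` {..<n})
              \<ge> (sqrt 2 - \<epsilon>) * opt_max_match (edist n) (basis_vec ` {..<n})}
       \<ge> 1 - exp (- c * real n * \<epsilon>^2) - real n powr (-50))"
\<comment> \<open>The 48000 is what the parameter estimates for small \<open>\<epsilon>\<close>
  require. The 0.0025 is the rate 0.005 of the fixed matching, expressed in
  \<open>n = 2 * m\<close>.\<close>
proof (rule exI[of _ 48000], rule exI[of _ "0.0025"], rule exI[of _ 1], intro conjI allI impI)
  fix \<epsilon> :: real and n t :: nat
  assume A: "0 < \<epsilon> \<and> \<epsilon> < 1 \<and> even n \<and> real n \<ge> 1 / \<epsilon>^2 \<and>
    48000 * ln (1/\<epsilon>) / \<epsilon>^2 \<le> real t \<and> real t \<le> ln (real n) / (48000 * ln (1/\<epsilon>))"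
  then have \<epsilon>: "0 < \<epsilon>" "\<epsilon> < 1" by auto
  obtain m where nm: "n = 2 * m" using A by (auto elim: evenE)
  have "0 < 1 / \<epsilon>^2" using \<epsilon> by simp
  then have n: "n \<ge> 1" using A by (cases n) auto
  have "0 < 48000 * ln (1/\<epsilon>) / \<epsilon>^2" using \<epsilon> by simp
  also have "\<dots> \<le> real t" using A by blast
  finally have t: "t \<ge> 1" by simp
  interpret gaussian_matrix t n by unfold_locales (rule t n)+
  define W where "W c = {G \<in> space (gaussian_JL t n).
    opt_max_match (edist t) (apply_mat t n G ` basis_vec ` {..<n}) \<ge> c}" for c
  define opt where "opt = opt_max_match (edist n) (basis_vec ` {..<n})"
  have "1.4 \<le> sqrt 2" by (rule real_le_rsqrt) (simp add: power2_eq_square)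
  then have "(sqrt 2 - \<epsilon>) * opt \<le> (sqrt 2 - \<epsilon>) * (real n / 2 * sqrt 2)"
    using opt_max_match_basis_vec_le[of n] \<epsilon> unfolding opt_def by (intro mult_left_mono) auto
  also have "\<dots> = (2 - sqrt 2 * \<epsilon>) * real m" by (simp add: nm algebra_simps)
  also have "\<dots> \<le> (2 - 1.4 * \<epsilon>) * real m"
    using \<open>1.4 \<le> sqrt 2\<close> \<epsilon> by (intro mult_right_mono diff_left_mono) auto
  finally have target: "(sqrt 2 - \<epsilon>) * opt \<le> (2 - 1.4 * \<epsilon>) * real m" .
  show "prob {G \<in> space (gaussian_JL t n). opt_max_match (edist t) (apply_mat t n G ` basis_vec ` {..<n})
        \<ge> (sqrt 2 - \<epsilon>) * opt_max_match (edist n) (basis_vec ` {..<n})}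
      \<ge> 1 - exp (- 0.0025 * real n * \<epsilon>^2) - real n powr (-50)"
  \<comment> \<open>Up to 0.9, \<open>\<delta> = \<epsilon> / 10\<close> gives the factor
    \<open>2 - 0.8 * \<epsilon>\<close>, above the target \<open>2 - 1.4 * \<epsilon>\<close>, with
    failure probability at most \<open>n powr (-50)\<close>. Beyond 0.9, the target is below
    \<open>2 - 1.26 = 0.74\<close>, and the exponential term covers the failure because
    \<open>\<epsilon>^2 \<le> 1\<close>.\<close>
  proof (cases "\<epsilon> \<le> 0.9")
    case True
    note par = antipodal_matching_parameters[OF \<epsilon>(1) True t _ _ n]
    have 1: "2 * exp (- real t * (\<epsilon> / 10)\<^sup>2 / 8) \<le> \<epsilon> / 10"
      using A by (intro par) auto
    have 2: "2 / (\<epsilon> / 10 * exp (-7)) ^ t * exp (- real n * (\<epsilon> / 10 * (\<epsilon> / 10 * exp (-7)) ^ t)\<^sup>2)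
        \<le> real n powr (-50)"
      using A by (intro par) auto
    have "(sqrt 2 - \<epsilon>) * opt \<le> (2 - 8 * (\<epsilon> / 10)) * real m"
      using \<epsilon> by (intro order_trans[OF target] mult_right_mono) auto
    then have "prob (W ((2 - 8 * (\<epsilon> / 10)) * real m)) \<le> prob (W ((sqrt 2 - \<epsilon>) * opt))"
      unfolding W_def by (rule prob_event_antimono)
    moreover have "prob (W ((2 - 8 * (\<epsilon> / 10)) * real m)) \<ge> 1 - real n powr (-50)"
      using prob_antipodal_matching[OF nm, of "\<epsilon> / 10"] \<epsilon> 1 2 by (simp add: W_def nm)
    ultimately show ?thesis unfolding W_def opt_def using exp_ge_zero by (smt (verit))
  next
    case False
    have "(sqrt 2 - \<epsilon>) * opt \<le> 0.74 * real m"
      using False by (intro order_trans[OF target] mult_right_mono) auto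
    then have "prob (W (0.74 * real m)) \<le> prob (W ((sqrt 2 - \<epsilon>) * opt))"
      unfolding W_def by (rule prob_event_antimono)
    moreover have "prob (W (0.74 * real m)) \<ge> 1 - exp (- 0.005 * real m)"
      unfolding W_def by (rule prob_fixed_matching[OF nm])
    moreover have "exp (- 0.005 * real m) \<le> exp (- 0.0025 * real n * \<epsilon>^2)"
      using power_le_one[of \<epsilon> 2] \<epsilon> by (simp add: nm mult_left_le)
    ultimately show ?thesis unfolding W_def opt_def using powr_ge_zero by (smt (verit))
  qed
qed auto

end
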